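(* Let $\Omega=B(0,R)\subset\mathbb R^3$ and let $B_0$ be the vector field given, in spherical coordinates $(r,\theta,\phi)$ ($r=|x|$, $\theta$ azimuthal angle, $\phi$ polar angle measured from the positive $z$-axis, with unit vectors $\hat r,\hat\theta,\hat\phi$), by $$B_0=C(R)\hat z-\frac{3R}{r^2\sinh R}\Big(\cosh r-\frac{\sinh r}{r}\Big)\cos\phi\,\hat r+\frac{3R}{2r^2\sinh R}\Big(\frac{1+r^2}{r}\sinh r-\cosh r\Big)\sin\phi\,\hat\phi,$$ $$C(R)=\frac{3}{2R\sinh R}\Big(\frac{1+R^2}{R}\sinh R-\cosh R\Big)$$ (this is the field $B_0$ associated with the Meissner state for the applied field $H_{0,\mathrm{ex}}=\hat z$). Let $\Gamma_0$ be the vertical diameter $\{(0,0,z):|z|\le R\}$ seen as a $1$-current with multiplicity $1$, oriented in the direction of the positive $z$-axis. Then $\Gamma_0$ is the unique element of $X$ with $\mathcal R(\Gamma_0)=\sup_{\Gamma\in\mathcal N}\mathcal R(\Gamma)$, and there exists $C_0>0$ depending only on $R$ such that $$\mathcal R(\Gamma_0)-\mathcal R(\Gamma)\ge C_0\min\big(\|\Gamma-\Gamma_0\|_*^2,1\big)\quad\text{for every }\Gamma\in X.$$ That is, the Nondegeneracy Condition holds with exponent $N=2$.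
   Context: $\mathcal N$ is the space of normal $1$-currents supported in $\overline\Omega$ with boundary supported on $\partial\Omega$; $|\Gamma|$ is the mass; $\langle B,\Gamma\rangle$ the action of $\Gamma$ on the vector field $B$ viewed as a $1$-form; $\mathcal R(\Gamma)=\langle B_0,\Gamma\rangle/|\Gamma|$. $X$ is the class of elements of $\mathcal N$ which are simple oriented Lipschitz curves (loops in $\overline\Omega$ or curves with both endpoints on $\partial\Omega$). $C^{0,1}_T(\Omega,\mathbb R^3)$ is the space of Lipschitz vector fields $B$ with $B\times\vec\nu=0$ on $\partial\Omega$, and $\|\Gamma\|_*=\sup\{\langle B,\Gamma\rangle:\|B\|_{C^{0,1}_T(\Omega,\mathbb R^3)}\le1\}$. *)

theory Defs
  imports "HOL-Analysis.Analysis" "HOL-Analysis.Cross3"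
begin

type_synonym field3 = "real^3 \<Rightarrow> real^3"
type_synonym current1 = "field3 \<Rightarrow> real"

coinductive smooth3 :: "(real^3 \<Rightarrow> real) \<Rightarrow> bool" where
  "(\<forall>x. f differentiable (at x)) \<Longrightarrow>
   (\<forall>i. smooth3 (\<lambda>x. frechet_derivative f (at x) (axis i 1))) \<Longrightarrow> smooth3 f"

definition test_fn :: "(real^3 \<Rightarrow> real) \<Rightarrow> bool" where
  "test_fn f \<longleftrightarrow> smooth3 f \<and> compact (closure {x. f x \<noteq> 0})"

definition test_form :: "field3 \<Rightarrow> bool" where
  "test_form w \<longleftrightarrow> (\<forall>i. smooth3 (\<lambda>x. w x $ i)) \<and> compact (closure {x. w x \<noteq> 0})"

definition grad3 :: "(real^3 \<Rightarrow> real) \<Rightarrow> field3" where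
  "grad3 f = (\<lambda>x. \<chi> i. frechet_derivative f (at x) (axis i 1))"

text \<open>A 1-current of finite mass supported in the closed ball cball 0 R, acting on
  continuous vector fields (the extension of the current from test forms):
  it is integration against tau d mu, mu a finite Borel measure on cball 0 R and
  tau a unit vector field. Only the values on fields continuous on cball 0 R
  are specified.\<close>
definition finite_mass_current :: "real \<Rightarrow> current1 \<Rightarrow> bool" where
  "finite_mass_current R T \<longleftrightarrow>
     (\<exists>(\<mu>::(real^3) measure) (\<tau>::field3).
        finite_measure \<mu> \<and> sets \<mu> = sets (restrict_space borel (cball 0 R)) \<and>
        \<tau> \<in> borel_measurable \<mu> \<and> (\<forall>x. norm (\<tau> x) = 1) \<and>
        (\<forall>B. continuous_on (cball 0 R) B \<longrightarrow> T B = (\<integral>x. B x \<bullet> \<tau> x \<partial>\<mu>)))"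

definition mass :: "current1 \<Rightarrow> real" where
  "mass T = (SUP w\<in>{w. test_form w \<and> (\<forall>x. norm (w x) \<le> 1)}. T w)"

text \<open>The space N: normal 1-currents supported in the closed ball with boundary
  (\<partial>T)(f) = T(df) supported on the sphere.\<close>
definition normal_currents :: "real \<Rightarrow> current1 set" where
  "normal_currents R = {T. finite_mass_current R T \<and>
      (\<exists>M. \<forall>f. test_fn f \<and> (\<forall>x. \<bar>f x\<bar> \<le> 1) \<longrightarrow> T (grad3 f) \<le> M) \<and>
      (\<forall>f. test_fn f \<and> closure {x. f x \<noteq> 0} \<inter> sphere 0 R = {} \<longrightarrow> T (grad3 f) = 0)}"

definition same_current :: "current1 \<Rightarrow> current1 \<Rightarrow> bool" where
  "same_current S T \<longleftrightarrow> (\<forall>w. test_form w \<longrightarrow> S w = T w)"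

definition simple_lip_curve :: "real \<Rightarrow> (real \<Rightarrow> real^3) \<Rightarrow> bool" where
  "simple_lip_curve R \<gamma> \<longleftrightarrow>
     (\<exists>L. L-lipschitz_on {0..1} \<gamma>) \<and> \<gamma> ` {0..1} \<subseteq> cball 0 R \<and>
     ((\<gamma> 0 = \<gamma> 1 \<and> inj_on \<gamma> {0..<1}) \<or>
      (inj_on \<gamma> {0..1} \<and> \<gamma> 0 \<in> sphere 0 R \<and> \<gamma> 1 \<in> sphere 0 R))"

definition curve_current :: "(real \<Rightarrow> real^3) \<Rightarrow> current1" where
  "curve_current \<gamma> B =
     (LINT t:{0..1}|lborel. B (\<gamma> t) \<bullet> vector_derivative \<gamma> (at t within {0..1}))"

definition curves_X :: "real \<Rightarrow> current1 set" where
  "curves_X R = {T \<in> normal_currents R. \<exists>\<gamma>. simple_lip_curve R \<gamma> \<and>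
      (\<forall>B. continuous_on (cball 0 R) B \<longrightarrow> T B = curve_current \<gamma> B)}"

definition lipT :: "real \<Rightarrow> field3 \<Rightarrow> bool" where
  "lipT R B \<longleftrightarrow> (\<exists>L. L-lipschitz_on (cball 0 R) B) \<and>
     (\<forall>x\<in>sphere 0 R. cross3 (B x) ((1/R) *\<^sub>R x) = 0)"

definition C01_norm :: "real \<Rightarrow> field3 \<Rightarrow> real" where
  "C01_norm R B = (SUP x\<in>cball 0 R. norm (B x)) +
     (SUP p\<in>{(x,y). x \<in> cball 0 R \<and> y \<in> cball 0 R \<and> x \<noteq> y}.
        norm (B (fst p) - B (snd p)) / dist (fst p) (snd p))"

definition dual_norm_diff :: "real \<Rightarrow> current1 \<Rightarrow> current1 \<Rightarrow> real" where
  "dual_norm_diff R S T = (SUP B\<in>{B. lipT R B \<and> C01_norm R B \<le> 1}. S B - T B)"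

definition C_R :: "real \<Rightarrow> real" where
  "C_R R = 3 / (2 * R * sinh R) * ((1 + R\<^sup>2) / R * sinh R - cosh R)"

text \<open>Written in Cartesian coordinates x = (x1,x2,x3), r = |x|:
  cos(phi) r_hat = (x3/r) (x/r) and sin(phi) phi_hat = (x1 x3, x2 x3, -(x1^2+x2^2))/r^2,
  z_hat = (0,0,1). At the origin the (removable) limit value is used.\<close>
definition B0 :: "real \<Rightarrow> field3" where
  "B0 R x = (let r = norm x; zh = vector [0, 0, 1] :: real^3 in
     if x = 0 then (C_R R - R / sinh R) *\<^sub>R zh
     else C_R R *\<^sub>R zh
       - (3 * R / (r\<^sup>2 * sinh R) * (cosh r - sinh r / r) * (x $ 3 / r)) *\<^sub>R ((1 / r) *\<^sub>R x)
       + (3 * R / (2 * r\<^sup>2 * sinh R) * ((1 + r\<^sup>2) / r * sinh r - cosh r)) *\<^sub>R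
           ((1 / r\<^sup>2) *\<^sub>R (vector [x $ 1 * x $ 3, x $ 2 * x $ 3, - ((x $ 1)\<^sup>2 + (x $ 2)\<^sup>2)] :: real^3)))"

definition ratio :: "real \<Rightarrow> current1 \<Rightarrow> real" where
  "ratio R T = T (B0 R) / mass T"

definition Gamma0 :: "real \<Rightarrow> current1" where
  "Gamma0 R B = (LINT z:{-R..R}|lborel. B (vector [0, 0, z]) $ 3)"

end

theory Submission
  imports Defs "HOL-Computational_Algebra.Polynomial"
begin

text \<open>
  The maximality of the diameter is a calibration argument. In terms of \<open>s = |x|\<^sup>2\<close> and entire power
  series in \<open>s\<close>, the field splits as \<open>B0 = \<omega> + \<nabla>f\<close>, where \<open>f\<close> vanishes on the sphere, so that
  \<open>\<nabla>f\<close> is invisible to every normal current, while \<open>|\<omega>|\<^sup>2 \<le> \<lambda>\<^sup>2 - a \<rho>\<^sup>2\<close> with \<open>\<rho>\<close> the distance to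
  the vertical axis and \<open>\<omega> = \<lambda> e\<^sub>3\<close> on the axis. Hence \<open>\<lambda>\<close> is the supremum of the ratio.

  Stability comes from perturbing the calibration: if \<open>V\<close> is bounded and its vertical component is
  \<open>O(\<rho>)\<close>, then \<open>|\<omega> + \<epsilon> V| \<le> \<lambda> + O(\<epsilon>\<^sup>2)\<close>, so a current \<open>T\<close> whose ratio is \<open>\<lambda> - \<delta>\<^sup>2\<close> satisfies
  \<open>T(V) = O(\<delta> |T|)\<close>. For a curve from \<open>p\<close> to \<open>q\<close> this is applied to gradients: \<open>x\<^sub>3\<close> bounds the
  length by the vertical displacement, \<open>x\<^sub>i\<close> and \<open>x\<^sub>i (x\<^sub>3 - c)\<close> for \<open>i = 1, 2\<close> force \<open>p\<close> and \<open>q\<close> to lie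
  within \<open>O(\<delta>)\<close> of the axis and then, both being on the sphere, at opposite poles. A Lipschitz field
  \<open>B\<close> differs from \<open>B\<^sub>3(0,0,x\<^sub>3) e\<^sub>3\<close> by such a \<open>V\<close>, and the latter field is a gradient.
\<close>

text \<open>The function f is dictated by the radial component: removing \<nabla>f has to leave
  \<lambda> times the vertical unit vector plus a field orthogonal to x. This is a linear
  first-order equation for the profile of f, and its solution regular at the origin is not
  elementary. Power series with positive coefficients replace it: they give smoothness at the
  origin, where spherical coordinates degenerate, and the positivity and monotonicity on which the
  bound for |\<omega>| rests. Two gaps in the definitions have to be bridged.
  \<open>normal_currents\<close> annihilates gradients of functions supported away from the sphere,
  while f only vanishes on it; the finite boundary mass closes this gap. And \<open>mass\<close>
  tests smooth compactly supported forms, while perturbed calibrations are only continuous on the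
  ball. The exponent 2 is a balance: a deficit \<delta>^2 is compared with a perturbation of size
  \<epsilon> whose cost is O(\<epsilon>^2), so T(V) is at most of order \<delta>^2/\<epsilon> +
  \<epsilon>, and \<epsilon> of order \<delta> is optimal. No lower bound on the mass of a nearly
  optimal curve is known in advance, so the endpoint estimates stay homogeneous in the mass until it
  cancels.\<close>

section \<open>Lipschitz curves\<close>

text \<open>The density is the Radon-Nikodym derivative of the image of Lebesgue measure under the inverse of
  the bi-Lipschitz map \<open>x \<mapsto> g x + (L + 1) x\<close>.\<close>
lemma lipschitz_indefinite_integral:
  fixes g :: "real \<Rightarrow> real"
  assumes g: "L-lipschitz_on UNIV g"
  shows "\<exists>f. \<forall>a b. a \<le> b \<longrightarrow> (f has_integral (g b - g a)) {a..b}"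
proof -
  have L0: "L \<ge> 0" using g by (rule lipschitz_on_nonneg)
  have gd: "\<bar>g x - g y\<bar> \<le> L * \<bar>x - y\<bar>" for x y
    using lipschitz_onD[OF g, of x y] by (simp add: dist_real_def)
  define F where "F x = g x + (L + 1) * x" for x
  have F_ge: "F y - F x \<ge> y - x" if "x \<le> y" for x y
    using gd[of x y] that by (simp add: F_def algebra_simps abs_le_iff)
  have F_le: "\<bar>F y - F x\<bar> \<le> (2 * L + 1) * \<bar>y - x\<bar>" for x y
  proof -
    have "\<bar>F y - F x\<bar> \<le> \<bar>g y - g x\<bar> + \<bar>(L + 1) * (y - x)\<bar>"
      unfolding F_def by (simp add: algebra_simps)
    also have "\<dots> \<le> (2 * L + 1) * \<bar>y - x\<bar>"
      using gd[of y x] L0 abs_mult[of "L + 1" "y - x"] by (simp add: distrib_right)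
    finally show ?thesis .
  qed
  have lipF: "(2 * L + 1)-lipschitz_on UNIV F"
    using F_le L0 by (intro lipschitz_onI) (auto simp: dist_real_def abs_minus_commute)
  have contF: "continuous_on S F" for S
    using lipschitz_on_continuous_on[OF lipF] continuous_on_subset by blast
  have strF: "strict_mono F"
  proof (rule strict_monoI)
    fix x y :: real assume "x < y"
    then show "F x < F y" using F_ge[of x y] by simp
  qed
  have "\<exists>x. F x = y" for y
  proof -
    define M where "M = \<bar>y - F 0\<bar>"
    have "F (-M) \<le> y" using F_ge[of "-M" 0] by (simp add: M_def)
    moreover have "y \<le> F M" using F_ge[of 0 M] by (simp add: M_def)
    ultimately show ?thesis
      using IVT'[of F "-M" y M] contF by (auto simp: M_def)
  qed
  then have surjF: "surj F" by (metis surjI surj_def)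
  have injF: "inj F" using strF by (rule strict_mono_imp_inj_on)
  define G where "G = inv F"
  have GF[simp]: "G (F x) = x" for x by (simp add: G_def injF)
  have FG[simp]: "F (G x) = x" for x by (simp add: G_def surjF surj_f_inv_f)
  have monoG: "mono G"
    by (rule monoI) (metis FG strF strict_mono_less_eq)
  have G_meas[measurable]: "G \<in> borel_measurable borel"
    by (rule borel_measurable_mono[OF monoG])
  have vim: "G -` A = F ` A" for A by (auto simp: image_iff) (metis FG)
  \<comment> \<open>\<open>N\<close> gives a set the Lebesgue measure of its image under
    \<open>F\<close>: null sets stay null because \<open>F\<close> is Lipschitz, and an interval
    receives the increment of \<open>F\<close>.\<close>
  define N where "N = distr lborel borel G"
  have ac: "absolutely_continuous lborel N"
    unfolding absolutely_continuous_def
  proof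
    fix A :: "real set" assume A: "A \<in> null_sets lborel"
    then have "negligible A"
      using negligible_iff_null_sets null_sets_completionI by blast
    then have "negligible (F ` A)"
      by (rule negligible_locally_Lipschitz_image[OF order_refl])
        (use F_le in \<open>auto intro!: exI[of _ UNIV] exI[of _ "2 * L + 1"]\<close>)
    moreover have As: "A \<in> sets borel" using A by auto
    then have "F ` A \<in> sets borel"
      using measurable_sets[OF G_meas As] vim by simp
    ultimately have "F ` A \<in> null_sets lborel"
      by (simp add: negligible_iff_null_sets null_sets_completion_iff)
    then show "A \<in> null_sets N"
      using As by (auto simp: N_def null_sets_def emeasure_distr vim)
  qed
  obtain f0 where f0[measurable]: "f0 \<in> borel_measurable borel" and dens: "density lborel f0 = N"
    using sigma_finite_measure.Radon_Nikodym[OF lborel.sigma_finite_measure_axioms ac] by (auto simp: N_def)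
  have emN: "(\<integral>\<^sup>+x. f0 x * indicator {a..b} x \<partial>lborel) = ennreal (F b - F a)" if "a \<le> b" for a b
  proof -
    have "G -` {a..b} = {F a..F b}"
      unfolding vim by (auto simp: strict_mono_less_eq[OF strF] image_iff)
        (metis FG strF strict_mono_less_eq atLeastAtMost_iff)
    moreover have "F a \<le> F b" using that strF by (simp add: strict_mono_less_eq)
    ultimately have "emeasure N {a..b} = ennreal (F b - F a)"
      by (simp add: N_def emeasure_distr)
    then show ?thesis by (simp flip: dens add: emeasure_density)
  qed
  define f1 where "f1 x = enn2real (f0 x)" for x
  have f1_int: "(f1 has_integral (F b - F a)) {a..b}" if ab: "a \<le> b" for a b
  proof -
    have "AE x in lborel. f0 x * indicator {a..b} x \<noteq> \<infinity>"
      by (rule nn_integral_PInf_AE) (use emN[OF ab] in auto)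
    then have "(\<integral>\<^sup>+x. ennreal (f1 x * indicator {a..b} x) \<partial>lborel)
        = (\<integral>\<^sup>+x. f0 x * indicator {a..b} x \<partial>lborel)"
      by (intro nn_integral_cong_AE)
        (auto simp: f1_def indicator_def ennreal_enn2real_if)
    also have "\<dots> = ennreal (F b - F a)" by (rule emN[OF ab])
    finally have "((\<lambda>x. f1 x * indicator {a..b} x) has_integral (F b - F a)) UNIV"
      using strF ab by (intro nn_integral_has_integral) (auto simp: f1_def strict_mono_less_eq)
    then have "((\<lambda>x. if x \<in> {a..b} then f1 x else 0) has_integral (F b - F a)) UNIV"
      by (rule has_integral_eq[rotated]) auto
    then show ?thesis by (simp only: has_integral_restrict_UNIV)
  qed
  have "((\<lambda>x. f1 x - (L + 1)) has_integral (g b - g a)) {a..b}" if "a \<le> b" for a b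
    using has_integral_diff[OF f1_int[OF that] has_integral_const_real[of "L + 1" a b]] that
    by (simp add: F_def algebra_simps)
  then show ?thesis by blast
qed

section \<open>Almost everywhere differentiability of real Lipschitz functions\<close>

lemma negligible_imp_AE_lborel:
  assumes "negligible N" shows "AE x in lborel. x \<notin> N"
  using assms AE_completion_iff AE_not_in[of N "lebesgue"] negligible_iff_null_sets by blast

lemma AE_lborel_imp_negligible:
  fixes P :: "'a::euclidean_space \<Rightarrow> bool"
  assumes "AE x in lborel. P x" shows "negligible {x. \<not> P x}"
  using assms unfolding negligible_iff_null_sets
  by (simp add: eventually_ae_filter null_sets_completion_iff2)

text \<open>Lebesgue differentiation applied to the density just constructed. Having one
  \<open>f\<close> serve both as density and as derivative is what later allows a chain rule to be
  integrated.\<close>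

lemma lipschitz_AE_differentiable:
  fixes g :: "real \<Rightarrow> real"
  assumes g: "L-lipschitz_on UNIV g"
  shows "\<exists>f. (\<forall>a b. a \<le> b \<longrightarrow> (f has_integral (g b - g a)) {a..b}) \<and>
    (AE x in lborel. (g has_real_derivative f x) (at x))"
proof -
  obtain f where f: "\<And>a b. a \<le> b \<Longrightarrow> (f has_integral (g b - g a)) {a..b}"
    using lipschitz_indefinite_integral[OF g] by blast
  \<comment> \<open>The averages in \<open>integrable_ccontinuous_explicit\<close> run over
    intervals that start at the point, so they only yield right derivatives; the reflected density
    supplies the left ones.\<close>
  have fm: "((\<lambda>x. f (- x)) has_integral (g (- a) - g (- b))) {a..b}" if "a \<le> b" for a b
    using f[of "-b" "-a"] has_integral_reflect_real[where f=f and a="-b" and b="-a"] that by simp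
  have "f integrable_on cbox a b" for a b :: real
    using f[of a b] by (cases "a \<le> b") (auto simp: integrable_on_def)
  then obtain N1 where N1: "negligible N1"
    and d1: "\<And>x e. \<lbrakk>x \<notin> N1; 0 < e\<rbrakk> \<Longrightarrow> \<exists>d>0. \<forall>h. 0 < h \<and> h < d \<longrightarrow>
         norm (integral (cbox x (x + h *\<^sub>R One)) f /\<^sub>R h ^ DIM(real) - f x) < e"
    using integrable_ccontinuous_explicit[of f] by blast
  have "(\<lambda>x. f (- x)) integrable_on cbox a b" for a b :: real
    using fm[of a b] by (cases "a \<le> b") (auto simp: integrable_on_def)
  then obtain N2 where N2: "negligible N2"
    and d2: "\<And>x e. \<lbrakk>x \<notin> N2; 0 < e\<rbrakk> \<Longrightarrow> \<exists>d>0. \<forall>h. 0 < h \<and> h < d \<longrightarrow>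
         norm (integral (cbox x (x + h *\<^sub>R One)) (\<lambda>x. f (- x)) /\<^sub>R h ^ DIM(real) - f (- x)) < e"
    using integrable_ccontinuous_explicit[of "\<lambda>x. f (- x)"] by blast
  have N2': "negligible (uminus ` N2)"
    by (rule negligible_locally_Lipschitz_image[OF order_refl N2])
      (auto simp: dist_real_def intro!: exI[of _ UNIV] exI[of _ "1::real"])
  have der: "(g has_real_derivative f x) (at x)" if x1: "x \<notin> N1" and x2: "x \<notin> uminus ` N2" for x
    unfolding DERIV_def LIM_def
  proof (intro allI impI)
    fix e :: real assume e: "e > 0"
    from d1[OF x1 e] obtain a where a: "a > 0"
      and ah: "\<And>h. 0 < h \<Longrightarrow> h < a \<Longrightarrow> norm (integral (cbox x (x + h *\<^sub>R One)) f /\<^sub>R h ^ DIM(real) - f x) < e"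
      by blast
    have "- x \<notin> N2" using x2 by (metis image_eqI minus_minus)
    from d2[OF this e] obtain b where b: "b > 0"
      and bh: "\<And>h. 0 < h \<Longrightarrow> h < b \<Longrightarrow>
        norm (integral (cbox (-x) (-x + h *\<^sub>R One)) (\<lambda>x. f (-x)) /\<^sub>R h ^ DIM(real) - f (- (-x))) < e"
      by blast
    have "dist ((g (x + h) - g x) / h) (f x) < e" if h: "h \<noteq> 0" "\<bar>h\<bar> < min a b" for h
    proof (cases "h > 0")
      case True
      have "integral {x..x + h} f = g (x + h) - g x"
        using f[of x "x + h"] True by (intro integral_unique) auto
      then show ?thesis using ah[of h] h True by (simp add: dist_real_def divide_inverse mult.commute)
    next
      case False
      have "integral {-x..-x + -h} (\<lambda>x. f (-x)) = g (- (- x)) - g (- (-x + -h))"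
        using fm[of "-x" "-x + -h"] False by (intro integral_unique) auto
      then have "integral {-x..-x + -h} (\<lambda>x. f (-x)) = g x - g (x + h)" by (simp add: add.commute)
      moreover have "(g (x + h) - g x) / h = (g x - g (x + h)) /\<^sub>R (-h)"
        using h by (simp add: field_simps)
      moreover have "\<bar>(g x - g (x + h)) /\<^sub>R (-h) - f x\<bar> < e"
        using bh[of "-h"] h False calculation(1) by simp
      ultimately show ?thesis using h by (simp add: dist_real_def)
    qed
    then show "\<exists>s>0. \<forall>h. h \<noteq> 0 \<and> dist h 0 < s \<longrightarrow> dist ((g (x + h) - g x) / h) (f x) < e"
      using a b by (intro exI[of _ "min a b"]) auto
  qed
  have "AE x in lborel. (g has_real_derivative f x) (at x)"
    using negligible_imp_AE_lborel[OF N1] negligible_imp_AE_lborel[OF N2']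
    by eventually_elim (rule der)
  with f show ?thesis by blast
qed

section \<open>Vector derivatives of curves: measurability, existence and bounds\<close>

lemma has_vector_derivative_iff_quotient:
  fixes f :: "real \<Rightarrow> 'a::real_normed_vector"
  shows "(f has_vector_derivative v) (at t) \<longleftrightarrow> ((\<lambda>h. (f (t + h) - f t) /\<^sub>R h) \<longlongrightarrow> v) (at 0)"
proof -
  have "(f has_vector_derivative v) (at t) \<longleftrightarrow>
      ((\<lambda>h. norm (f (t + h) - f t - h *\<^sub>R v) / norm h) \<longlongrightarrow> 0) (at 0)"
    unfolding has_vector_derivative_def has_derivative_at by (simp add: bounded_linear_scaleR_left)
  also have "\<dots> \<longleftrightarrow> ((\<lambda>h. norm ((f (t + h) - f t) /\<^sub>R h - v)) \<longlongrightarrow> 0) (at 0)"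
  proof (rule filterlim_cong[OF refl refl])
    show "\<forall>\<^sub>F h in at 0. norm (f (t + h) - f t - h *\<^sub>R v) / norm h = norm ((f (t + h) - f t) /\<^sub>R h - v)"
      unfolding eventually_at
    proof (intro exI[of _ 1] conjI ballI impI; simp)
      fix h :: real assume h: "h \<noteq> 0 \<and> \<bar>h\<bar> < 1"
      then have "(f (t + h) - f t) /\<^sub>R h - v = (f (t + h) - f t - h *\<^sub>R v) /\<^sub>R h"
        by (simp add: scaleR_right_diff_distrib)
      then show "norm (f (t + h) - f t - h *\<^sub>R v) / \<bar>h\<bar> = norm ((f (t + h) - f t) /\<^sub>R h - v)"
        by (simp add: divide_inverse)
    qed
  qed
  also have "\<dots> \<longleftrightarrow> ((\<lambda>h. (f (t + h) - f t) /\<^sub>R h) \<longlongrightarrow> v) (at 0)"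
    by (simp add: tendsto_norm_zero_iff LIM_zero_iff)
  finally show ?thesis .
qed

text \<open>Exhibits differentiability as a countable condition, hence as a Borel condition on the point.\<close>
lemma has_vector_derivative_exists_iff_rational_Cauchy:
  fixes f :: "real \<Rightarrow> 'a::banach"
  assumes f: "continuous_on UNIV f"
  defines "Q \<equiv> \<lambda>t h. (f (t + h) - f t) /\<^sub>R h"
  shows "(\<exists>v. (f has_vector_derivative v) (at t)) \<longleftrightarrow>
    (\<forall>n::nat. \<exists>m::nat. \<forall>h k::rat. h \<noteq> 0 \<and> k \<noteq> 0 \<and> \<bar>real_of_rat h\<bar> < 1 / real (Suc m) \<and> \<bar>real_of_rat k\<bar> < 1 / real (Suc m) \<longrightarrow>
      dist (Q t (of_rat h)) (Q t (of_rat k)) \<le> 1 / real (Suc n))"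
    (is "?L = ?R")
proof
  assume ?L
  then obtain v where v: "(Q t \<longlongrightarrow> v) (at 0)"
    unfolding Q_def by (auto simp: has_vector_derivative_iff_quotient)
  show ?R
  proof
    fix n :: nat
    have "0 < 1 / (2 * (real n + 1))" by simp
    then obtain d where d: "d > 0"
      and dh: "\<And>h. h \<noteq> 0 \<Longrightarrow> \<bar>h\<bar> < d \<Longrightarrow> dist (Q t h) v < 1 / (2 * (real n + 1))"
      using v unfolding LIM_def by (metis dist_real_def diff_zero)
    obtain m :: nat where m: "1 / (real m + 1) < d"
      using reals_Archimedean[OF d] by (auto simp: divide_inverse add.commute)
    show "\<exists>m::nat. \<forall>h k::rat. h \<noteq> 0 \<and> k \<noteq> 0 \<and> \<bar>real_of_rat h\<bar> < 1 / real (Suc m) \<and> \<bar>real_of_rat k\<bar> < 1 / real (Suc m) \<longrightarrow>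
      dist (Q t (of_rat h)) (Q t (of_rat k)) \<le> 1 / real (Suc n)"
    proof (intro exI[of _ m] allI impI)
      fix h k :: rat
      assume *: "h \<noteq> 0 \<and> k \<noteq> 0 \<and> \<bar>real_of_rat h\<bar> < 1 / real (Suc m) \<and> \<bar>real_of_rat k\<bar> < 1 / real (Suc m)"
      have "dist (Q t (of_rat h)) (Q t (of_rat k)) \<le> dist (Q t (of_rat h)) v + dist (Q t (of_rat k)) v"
        by (rule dist_triangle2)
      also have "\<dots> \<le> 1 / (2 * (real n + 1)) + 1 / (2 * (real n + 1))"
        using dh[of "of_rat h"] dh[of "of_rat k"] * m by (intro add_mono less_imp_le) (auto simp: add.commute)
      also have "\<dots> = 1 / real (Suc n)" by (simp add: field_simps)
      finally show "dist (Q t (of_rat h)) (Q t (of_rat k)) \<le> 1 / real (Suc n)" .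
    qed
  qed
next
  assume R: ?R
  have R': "\<exists>d>0. \<forall>h k::rat. h \<noteq> 0 \<and> k \<noteq> 0 \<and> \<bar>real_of_rat h\<bar> < d \<and> \<bar>real_of_rat k\<bar> < d \<longrightarrow>
      dist (Q t (of_rat h)) (Q t (of_rat k)) < e" if "e > 0" for e
  proof -
    obtain n :: nat where n: "1 / real (Suc n) < e"
      using reals_Archimedean[OF \<open>e > 0\<close>] by (auto simp: divide_inverse)
    obtain m :: nat where m: "\<And>h k::rat. h \<noteq> 0 \<and> k \<noteq> 0 \<and> \<bar>real_of_rat h\<bar> < 1 / real (Suc m) \<and> \<bar>real_of_rat k\<bar> < 1 / real (Suc m) \<Longrightarrow>
      dist (Q t (of_rat h)) (Q t (of_rat k)) \<le> 1 / real (Suc n)" using R by blast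
    show ?thesis
    proof (intro exI[of _ "1 / real (Suc m)"] conjI allI impI)
      show "dist (Q t (of_rat h)) (Q t (of_rat k)) < e"
        if "h \<noteq> 0 \<and> k \<noteq> 0 \<and> \<bar>real_of_rat h\<bar> < 1 / real (Suc m) \<and> \<bar>real_of_rat k\<bar> < 1 / real (Suc m)" for h k
        using m[OF that] n by (rule le_less_trans)
    qed simp
  qed
  \<comment> \<open>The steps 1/(n+1) only produce a candidate \<open>v\<close>. The Cauchy
    condition gives convergence along rational steps, and continuity of the quotient at a nonzero
    step extends it to real ones.\<close>
  define r where "r n = (1 / of_nat (Suc n) :: rat)" for n
  have r0: "r n \<noteq> 0" for n by (simp add: r_def)
  have rr: "real_of_rat (r n) = 1 / real (Suc n)" for n
    by (simp add: r_def of_rat_divide del: of_nat_Suc)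
  have rd: "\<forall>\<^sub>F n in sequentially. \<bar>real_of_rat (r n)\<bar> < d" if "d > 0" for d
    unfolding rr using LIMSEQ_inverse_real_of_nat that
    by (auto simp: LIMSEQ_iff eventually_sequentially divide_inverse)
  have "Cauchy (\<lambda>n. Q t (of_rat (r n)))"
  proof (rule metric_CauchyI)
    fix e :: real assume "e > 0"
    from R'[OF this] obtain d where d: "d > 0"
      and dh: "\<And>h k::rat. h \<noteq> 0 \<Longrightarrow> k \<noteq> 0 \<Longrightarrow> \<bar>real_of_rat h\<bar> < d \<Longrightarrow> \<bar>real_of_rat k\<bar> < d \<Longrightarrow>
        dist (Q t (of_rat h)) (Q t (of_rat k)) < e" by blast
    show "\<exists>M. \<forall>m\<ge>M. \<forall>n\<ge>M. dist (Q t (of_rat (r m))) (Q t (of_rat (r n))) < e"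
      using rd[OF d] dh r0 unfolding eventually_sequentially by meson
  qed
  then obtain v where v: "(\<lambda>n. Q t (of_rat (r n))) \<longlonglongrightarrow> v"
    using Cauchy_convergent convergent_def by blast
  have "(Q t \<longlongrightarrow> v) (at 0)"
    unfolding LIM_def
  proof (intro allI impI)
    fix e :: real assume e: "e > 0"
    then have e3: "e / 3 > 0" by simp
    from R'[OF e3] obtain d where d: "d > 0"
      and dh: "\<And>h k::rat. h \<noteq> 0 \<Longrightarrow> k \<noteq> 0 \<Longrightarrow> \<bar>real_of_rat h\<bar> < d \<Longrightarrow> \<bar>real_of_rat k\<bar> < d \<Longrightarrow>
        dist (Q t (of_rat h)) (Q t (of_rat k)) < e / 3" by blast
    obtain k where k: "k \<noteq> 0" "\<bar>real_of_rat k\<bar> < d" "dist (Q t (of_rat k)) v < e / 3"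
    proof -
      have "\<forall>\<^sub>F n in sequentially. \<bar>real_of_rat (r n)\<bar> < d \<and> dist (Q t (of_rat (r n))) v < e / 3"
        using rd[OF d] tendstoD[OF v e3] by eventually_elim auto
      then show thesis using r0 that by (auto simp: eventually_sequentially)
    qed
    have "dist (Q t h) v < e" if h: "h \<noteq> 0" "\<bar>h\<bar> < d" for h
    proof -
      have "isCont (Q t) h" unfolding Q_def
        using h f by (intro continuous_intros isCont_o2[where f = "\<lambda>h. t + h" and g = f])
          (auto simp: continuous_on_eq_continuous_at)
      then obtain \<delta> where \<delta>: "\<delta> > 0" and \<delta>h: "\<And>y. dist y h < \<delta> \<Longrightarrow> dist (Q t y) (Q t h) < e / 3"
        using e3 unfolding continuous_at_eps_delta by blast
      obtain q :: rat where q: "q \<noteq> 0" "\<bar>real_of_rat q\<bar> < d" "dist (of_rat q) h < \<delta>"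
      proof (cases "h > 0")
        case True
        then have "h < min (h + \<delta>) d" using h \<delta> by auto
        then obtain q where "h < real_of_rat q" "real_of_rat q < min (h + \<delta>) d"
          using of_rat_dense by blast
        then have "real_of_rat q > 0" "\<bar>real_of_rat q\<bar> < d" "dist (of_rat q) h < \<delta>"
          using True by (auto simp only: dist_real_def)
        then show thesis using that[of q] by auto
      next
        case False
        then have "h < min (h + \<delta>) 0" using h \<delta> by auto
        then obtain q where "h < real_of_rat q" "real_of_rat q < min (h + \<delta>) 0"
          using of_rat_dense by blast
        then have "real_of_rat q < 0" "\<bar>real_of_rat q\<bar> < d" "dist (of_rat q) h < \<delta>"
          using False h by (auto simp only: dist_real_def)
        then show thesis using that[of q] by auto
      qed
      have "dist (Q t h) v \<le> dist (Q t (of_rat q)) (Q t h) + dist (Q t (of_rat q)) (Q t (of_rat k)) + dist (Q t (of_rat k)) v"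
        using dist_triangle[of "Q t h" v "Q t (of_rat q)"] dist_triangle[of "Q t (of_rat q)" v "Q t (of_rat k)"]
        by (simp add: dist_commute)
      also have "\<dots> < e / 3 + e / 3 + e / 3"
        using \<delta>h[OF q(3)] dh[OF q(1) k(1) q(2) k(2)] k(3) by linarith
      finally show ?thesis by simp
    qed
    then show "\<exists>s>0. \<forall>x. x \<noteq> 0 \<and> dist x 0 < s \<longrightarrow> dist (Q t x) v < e"
      using d by (intro exI[of _ d]) auto
  qed
  then show ?L unfolding Q_def by (auto simp: has_vector_derivative_iff_quotient)
qed

text \<open>At points of non-differentiability \<open>vector_derivative\<close> takes one and the same junk value.\<close>
lemma borel_measurable_vector_derivative:
  fixes f :: "real \<Rightarrow> 'a::euclidean_space"
  assumes f: "continuous_on UNIV f"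
  shows "(\<lambda>t. vector_derivative f (at t)) \<in> borel_measurable borel"
proof -
  have [measurable]: "f \<in> borel_measurable borel"
    using f by (rule borel_measurable_continuous_onI)
  define P where "P t \<longleftrightarrow> (\<exists>v. (f has_vector_derivative v) (at t))" for t
  have [measurable]: "Measurable.pred borel P"
    unfolding P_def has_vector_derivative_exists_iff_rational_Cauchy[OF f] by measurable
  define W where "W t = lim (\<lambda>n. (f (t + 1 / real (Suc n)) - f t) /\<^sub>R (1 / real (Suc n)))" for t
  have [measurable]: "W \<in> borel_measurable borel"
    unfolding W_def by measurable
  have "vector_derivative f (at t) = (if P t then W t else (SOME v. False))" for t
  proof (cases "P t")
    case True
    then obtain v where v: "(f has_vector_derivative v) (at t)" by (auto simp: P_def)
    have "filterlim (\<lambda>n. 1 / real (Suc n)) (at 0) sequentially"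
      unfolding filterlim_at using LIMSEQ_inverse_real_of_nat by (simp add: divide_inverse)
    from filterlim_compose[OF v[unfolded has_vector_derivative_iff_quotient] this]
    have "W t = v" unfolding W_def by (rule limI)
    then show ?thesis using True v by (simp add: vector_derivative_at)
  next
    case False
    then show ?thesis by (simp add: P_def vector_derivative_def)
  qed
  then show ?thesis by simp
qed

lemma lipschitz_AE_vector_derivative:
  fixes \<gamma> :: "real \<Rightarrow> 'a::euclidean_space"
  assumes "L-lipschitz_on UNIV \<gamma>"
  shows "AE t in lborel. \<exists>v. (\<gamma> has_vector_derivative v) (at t)"
proof -
  have "\<exists>f. AE t in lborel. ((\<lambda>t. \<gamma> t \<bullet> i) has_real_derivative f t) (at t)" if "i \<in> Basis" for i
  proof -
    have "L-lipschitz_on UNIV (\<lambda>t. \<gamma> t \<bullet> i)"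
    proof (rule lipschitz_onI)
      fix x y
      have "dist (\<gamma> x \<bullet> i) (\<gamma> y \<bullet> i) \<le> dist (\<gamma> x) (\<gamma> y)"
        using Basis_le_norm[OF that, of "\<gamma> x - \<gamma> y"] by (simp add: dist_norm inner_diff_left)
      then show "dist (\<gamma> x \<bullet> i) (\<gamma> y \<bullet> i) \<le> L * dist x y"
        using lipschitz_onD[OF assms, of x y] by simp
    qed (rule lipschitz_on_nonneg[OF assms])
    from lipschitz_AE_differentiable[OF this] show ?thesis by blast
  qed
  then obtain f where f: "\<And>i. i \<in> Basis \<Longrightarrow> AE t in lborel. ((\<lambda>t. \<gamma> t \<bullet> i) has_real_derivative f i t) (at t)"
    by metis
  then have "AE t in lborel. \<forall>i\<in>Basis. ((\<lambda>t. \<gamma> t \<bullet> i) has_real_derivative f i t) (at t)"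
    by (intro AE_finite_allI) auto
  then show ?thesis
  proof eventually_elim
    case (elim t)
    have "(\<gamma> has_vector_derivative (\<Sum>i\<in>Basis. f i t *\<^sub>R i)) (at t)"
      unfolding has_vector_derivative_def
    proof (subst has_derivative_componentwise_within, intro ballI)
      fix i :: 'a assume "i \<in> Basis"
      then show "((\<lambda>t. \<gamma> t \<bullet> i) has_derivative (\<lambda>h. (h *\<^sub>R (\<Sum>i\<in>Basis. f i t *\<^sub>R i)) \<bullet> i)) (at t)"
        using elim by (simp add: has_field_derivative_def mult.commute[of _ "f i t"])
    qed
    then show ?case ..
  qed
qed

lemma norm_vector_derivative_lipschitz_le:
  fixes \<gamma> :: "real \<Rightarrow> 'a::real_normed_vector"
  assumes \<gamma>: "L-lipschitz_on UNIV \<gamma>" and v: "(\<gamma> has_vector_derivative v) (at t)"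
  shows "norm v \<le> L"
proof (rule Lim_norm_ubound)
  show "((\<lambda>h. (\<gamma> (t + h) - \<gamma> t) /\<^sub>R h) \<longlongrightarrow> v) (at 0)"
    using v by (simp add: has_vector_derivative_iff_quotient)
  show "\<forall>\<^sub>F h in at 0. norm ((\<gamma> (t + h) - \<gamma> t) /\<^sub>R h) \<le> L"
    unfolding eventually_at
  proof (intro exI[of _ 1] conjI ballI impI)
    fix h :: real assume h: "h \<noteq> 0 \<and> dist h 0 < 1"
    have "norm ((\<gamma> (t + h) - \<gamma> t) /\<^sub>R h) = norm (\<gamma> (t + h) - \<gamma> t) / \<bar>h\<bar>"
      by (simp add: divide_inverse mult.commute)
    then show "norm ((\<gamma> (t + h) - \<gamma> t) /\<^sub>R h) \<le> L"
      using lipschitz_onD[OF \<gamma>, of "t + h" t] h by (simp add: dist_norm pos_divide_le_eq)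
  qed simp
qed simp

text \<open>Along the curve \<open>u\<close> is Lipschitz, hence the integral of its almost
  everywhere derivative, which the chain rule identifies with the integrand. Differentiability is
  only asked within \<open>S\<close> because one later potential is a primitive defined over the
  heights occurring in the ball.\<close>

lemma curve_current_gradient:
  fixes \<gamma> :: "real \<Rightarrow> real^3"
  assumes \<gamma>: "L-lipschitz_on {0..1} \<gamma>" and S: "compact S" "convex S" and \<gamma>S: "\<gamma> ` {0..1} \<subseteq> S"
    and u: "\<And>x. x \<in> S \<Longrightarrow> (u has_derivative (\<lambda>h. U x \<bullet> h)) (at x within S)"
    and U: "continuous_on S U"
  shows "curve_current \<gamma> U = u (\<gamma> 1) - u (\<gamma> 0)"
proof -
  \<comment> \<open>Constant extension beyond [0,1] keeps the Lipschitz constant and makes two-sided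
    derivatives available.\<close>
  define \<gamma>' where "\<gamma>' t = \<gamma> (max 0 (min 1 t))" for t
  have L0: "L \<ge> 0" by (rule lipschitz_on_nonneg[OF \<gamma>])
  have lip': "L-lipschitz_on UNIV \<gamma>'"
  proof (rule lipschitz_onI)
    fix x y :: real
    have "dist (\<gamma>' x) (\<gamma>' y) \<le> L * dist (max 0 (min 1 x)) (max 0 (min 1 y))"
      unfolding \<gamma>'_def by (rule lipschitz_onD[OF \<gamma>]) auto
    also have "\<dots> \<le> L * dist x y"
      using L0 by (intro mult_left_mono) (auto simp: dist_real_def max_def min_def)
    finally show "dist (\<gamma>' x) (\<gamma>' y) \<le> L * dist x y" .
  qed (rule L0)
  have cont': "continuous_on UNIV \<gamma>'" by (rule lipschitz_on_continuous_on[OF lip'])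
  have \<gamma>'S: "\<gamma>' t \<in> S" for t using \<gamma>S by (auto simp: \<gamma>'_def max_def min_def)
  have \<gamma>'eq: "\<gamma>' t = \<gamma> t" if "t \<in> {0..1}" for t using that by (auto simp: \<gamma>'_def)
  obtain K where K: "\<And>x. x \<in> S \<Longrightarrow> norm (U x) \<le> K" and K0: "K \<ge> 0"
    using compact_imp_bounded[OF compact_continuous_image[OF U S(1)]]
    unfolding bounded_pos by (auto intro: less_imp_le)
  have lipu: "norm (u x - u y) \<le> K * norm (x - y)" if "x \<in> S" "y \<in> S" for x y
  proof (rule differentiable_bound[OF S(2) u _ that])
    show "onorm (\<lambda>h. U x \<bullet> h) \<le> K" if "x \<in> S" for x
    proof (rule onorm_bound)
      show "norm (U x \<bullet> h) \<le> K * norm h" for h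
        using Cauchy_Schwarz_ineq2[of "U x" h] K[OF that]
        by (smt (verit) mult_right_mono norm_ge_zero real_norm_def)
    qed (rule K0)
  qed auto
  have lipg: "(K * L)-lipschitz_on UNIV (\<lambda>t. u (\<gamma>' t))"
  proof (rule lipschitz_onI)
    fix x y :: real
    have "dist (u (\<gamma>' x)) (u (\<gamma>' y)) \<le> K * dist (\<gamma>' x) (\<gamma>' y)"
      using lipu[OF \<gamma>'S \<gamma>'S, of x y] by (simp add: dist_norm)
    also have "\<dots> \<le> K * (L * dist x y)"
      using lipschitz_onD[OF lip', of x y] K0 by (intro mult_left_mono) auto
    finally show "dist (u (\<gamma>' x)) (u (\<gamma>' y)) \<le> K * L * dist x y" by simp
  qed (use K0 L0 in auto)
  obtain f where f: "\<And>a b. a \<le> b \<Longrightarrow> (f has_integral (u (\<gamma>' b) - u (\<gamma>' a))) {a..b}"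
    and fd: "AE t in lborel. ((\<lambda>t. u (\<gamma>' t)) has_real_derivative f t) (at t)"
    using lipschitz_AE_differentiable[OF lipg] by blast
  define W where "W t = vector_derivative \<gamma>' (at t)" for t
  have [measurable]: "W \<in> borel_measurable borel"
    unfolding W_def by (rule borel_measurable_vector_derivative[OF cont'])
  define V where "V t = vector_derivative \<gamma> (at t within {0..1})" for t
  have VW: "V t = W t" if t: "t \<in> {0<..<1}" for t
  proof -
    have "(\<gamma> has_vector_derivative v) (at t within {0..1}) \<longleftrightarrow> (\<gamma>' has_vector_derivative v) (at t)" for v
    proof -
      have "(\<gamma> has_vector_derivative v) (at t within {0..1}) \<longleftrightarrow> (\<gamma> has_vector_derivative v) (at t)"
        using t by (subst at_within_interior) auto
      also have "\<dots> \<longleftrightarrow> (\<gamma>' has_vector_derivative v) (at t)"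
        by (rule iffI; erule has_vector_derivative_transform_within_open[where S = "{0<..<1}"])
          (use t \<gamma>'eq in auto)
      finally show ?thesis .
    qed
    then show ?thesis unfolding V_def W_def vector_derivative_def by simp
  qed
  define I where "I t = (if t \<in> {0<..<1} then U (\<gamma>' t) \<bullet> W t else 0)" for t
  have UI: "continuous_on UNIV (\<lambda>t. U (\<gamma>' t))"
    by (rule continuous_on_compose2[OF U cont']) (use \<gamma>'S in auto)
  have [measurable]: "(\<lambda>t. U (\<gamma>' t)) \<in> borel_measurable borel"
    by (rule borel_measurable_continuous_onI[OF UI])
  have I_meas[measurable]: "I \<in> borel_measurable borel" unfolding I_def by measurable
  have derivs: "AE t in lborel. ((\<lambda>t. u (\<gamma>' t)) has_real_derivative f t) (at t) \<and> (\<gamma>' has_vector_derivative W t) (at t)"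
    using fd lipschitz_AE_vector_derivative[OF lip']
    by eventually_elim (auto simp: W_def vector_derivative_at)
  have feq: "f t = U (\<gamma>' t) \<bullet> W t"
    if "((\<lambda>t. u (\<gamma>' t)) has_real_derivative f t) (at t)" and W: "(\<gamma>' has_vector_derivative W t) (at t)" for t
  proof -
    have "(u has_derivative (\<lambda>h. U (\<gamma>' t) \<bullet> h)) (at (\<gamma>' t) within range \<gamma>')"
      using u[OF \<gamma>'S] by (rule has_derivative_subset) (use \<gamma>'S in auto)
    from has_derivative_in_compose[OF W[unfolded has_vector_derivative_def] this]
    have "((\<lambda>t. u (\<gamma>' t)) has_real_derivative (U (\<gamma>' t) \<bullet> W t)) (at t)"
      by (simp add: has_field_derivative_def mult.commute[of _ "U (\<gamma>' t) \<bullet> W t"])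
    with that(1) show ?thesis by (rule DERIV_unique)
  qed
  have I_int: "set_integrable lborel {0..1} I"
    unfolding set_integrable_def
  proof (rule integrableI_bounded_set_indicator)
    show "AE t in lborel. t \<in> {0..1} \<longrightarrow> norm (I t) \<le> K * L"
      using derivs
    proof eventually_elim
      case (elim t)
      have "norm (I t) \<le> norm (U (\<gamma>' t)) * norm (W t)"
        using Cauchy_Schwarz_ineq2[of "U (\<gamma>' t)" "W t"] by (auto simp: I_def)
      also have "\<dots> \<le> K * L"
        using K[OF \<gamma>'S] norm_vector_derivative_lipschitz_le[OF lip', of "W t" t] elim K0
        by (intro mult_mono) auto
      finally show ?case by simp
    qed
  qed auto
  have "negligible {t. \<not> (((\<lambda>t. u (\<gamma>' t)) has_real_derivative f t) (at t) \<and> (\<gamma>' has_vector_derivative W t) (at t))}"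
    (is "negligible ?N")
    by (rule AE_lborel_imp_negligible[OF derivs])
  then have neg: "negligible (?N \<union> {0, 1})" by (simp add: negligible_Un_eq)
  have "curve_current \<gamma> U = (LINT t:{0..1}|lborel. U (\<gamma> t) \<bullet> V t)"
    by (simp add: curve_current_def V_def)
  also have "\<dots> = (LINT t:{0..1}|lborel. I t)"
  proof -
    \<comment> \<open>An almost everywhere identity does not transfer measurability over
      \<open>lborel\<close>, which is not complete; so the values at the two end points are carried
      along explicitly.\<close>
    have eqt: "indicat_real {0..1} t *\<^sub>R (U (\<gamma> t) \<bullet> V t) =
      indicat_real {0..1} t *\<^sub>R I t + (if t = 0 then U (\<gamma> 0) \<bullet> V 0 else if t = 1 then U (\<gamma> 1) \<bullet> V 1 else 0)" for t
      using VW[of t] \<gamma>'eq[of t] by (auto simp: indicator_def I_def)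
    then have eq: "(\<lambda>t. indicat_real {0..1} t *\<^sub>R (U (\<gamma> t) \<bullet> V t)) =
      (\<lambda>t. indicat_real {0..1} t *\<^sub>R I t + (if t = 0 then U (\<gamma> 0) \<bullet> V 0 else if t = 1 then U (\<gamma> 1) \<bullet> V 1 else 0))"
      by blast
    have meas: "(\<lambda>t. indicat_real {0..1} t *\<^sub>R (U (\<gamma> t) \<bullet> V t)) \<in> borel_measurable lborel"
      unfolding eq by measurable
    have "AE t in lborel. t \<noteq> (0::real)" "AE t in lborel. t \<noteq> (1::real)"
      by (rule AE_lborel_singleton)+
    then have "AE t in lborel. indicat_real {0..1} t *\<^sub>R (U (\<gamma> t) \<bullet> V t) = indicat_real {0..1} t *\<^sub>R I t"
      by eventually_elim (subst eqt, simp)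
    then show ?thesis
      unfolding set_lebesgue_integral_def by (intro integral_cong_AE meas) auto
  qed
  also have "\<dots> = integral {0..1} I"
    by (rule set_borel_integral_eq_integral(2)[OF I_int])
  also have "\<dots> = integral {0..1} f"
    by (rule integral_spike[OF neg]) (auto simp: I_def intro: feq)
  also have "\<dots> = u (\<gamma> 1) - u (\<gamma> 0)"
    using integral_unique[OF f[of 0 1]] \<gamma>'eq by simp
  finally show ?thesis .
qed

section \<open>Smooth functions\<close>

text \<open>A class containing all functions needed below and closed under partial derivatives, so that
  \<open>smooth3\<close> follows by coinduction.\<close>
inductive smooth_closure :: "(real^3 \<Rightarrow> real) \<Rightarrow> bool" where
  linear: "bounded_linear f \<Longrightarrow> smooth_closure f"
| const: "smooth_closure (\<lambda>x. c)"
| add: "smooth_closure f \<Longrightarrow> smooth_closure g \<Longrightarrow> smooth_closure (\<lambda>x. f x + g x)"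
| mult: "smooth_closure f \<Longrightarrow> smooth_closure g \<Longrightarrow> smooth_closure (\<lambda>x. f x * g x)"
| inverse: "smooth_closure f \<Longrightarrow> (\<And>x. f x \<noteq> 0) \<Longrightarrow> smooth_closure (\<lambda>x. inverse (f x))"
| compose: "smooth_closure f \<Longrightarrow> (\<And>n t. (U n has_real_derivative U (Suc n) t) (at t)) \<Longrightarrow>
    smooth_closure (\<lambda>x. U n (f x))" for U :: "nat \<Rightarrow> real \<Rightarrow> real"

text \<open>For \<open>compose\<close> the chain rule produces \<open>U (Suc n) (f x)\<close>, again
  an instance of the same rule; this is why that rule carries a whole sequence of derivatives
  instead of one function.\<close>

lemma smooth_closure_has_derivative:
  assumes "smooth_closure f"
  shows "\<exists>D. (\<forall>x. (f has_derivative D x) (at x)) \<and> (\<forall>i. smooth_closure (\<lambda>x. D x (axis i 1)))"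
  using assms
proof induction
  case (linear f)
  then show ?case
    by (intro exI[of _ "\<lambda>x. f"]) (auto intro: bounded_linear.has_derivative[of f, OF _ has_derivative_ident] smooth_closure.const)
next
  case (const c)
  show ?case by (intro exI[of _ "\<lambda>x h. 0"]) (auto intro: smooth_closure.const)
next
  case (add f g)
  then obtain D E where "\<forall>x. (f has_derivative D x) (at x)" "\<forall>i. smooth_closure (\<lambda>x. D x (axis i 1))"
    "\<forall>x. (g has_derivative E x) (at x)" "\<forall>i. smooth_closure (\<lambda>x. E x (axis i 1))" by blast
  then show ?case
    by (intro exI[of _ "\<lambda>x h. D x h + E x h"]) (auto intro!: has_derivative_add smooth_closure.add)
next
  case (mult f g)
  then obtain D E where "\<forall>x. (f has_derivative D x) (at x)" "\<forall>i. smooth_closure (\<lambda>x. D x (axis i 1))"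
    "\<forall>x. (g has_derivative E x) (at x)" "\<forall>i. smooth_closure (\<lambda>x. E x (axis i 1))" by blast
  with mult.hyps show ?case
    by (intro exI[of _ "\<lambda>x h. f x * E x h + D x h * g x"])
      (auto intro!: has_derivative_mult smooth_closure.add smooth_closure.mult)
next
  case (inverse f)
  then obtain D where D: "\<And>x. (f has_derivative D x) (at x)" "\<And>i. smooth_closure (\<lambda>x. D x (axis i 1))"
    by blast
  have "smooth_closure (\<lambda>x. (-1) * (inverse (f x) * D x (axis i 1) * inverse (f x)))" for i
    using inverse.hyps D(2) by (intro smooth_closure.mult smooth_closure.inverse smooth_closure.const)
  then show ?case using D(1) inverse.hyps
    by (intro exI[of _ "\<lambda>x h. - (inverse (f x) * D x h * inverse (f x))"]) (auto intro!: has_derivative_inverse)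
next
  case (compose U f n)
  then obtain D where D: "\<And>x. (f has_derivative D x) (at x)" "\<And>i. smooth_closure (\<lambda>x. D x (axis i 1))"
    by blast
  have "((\<lambda>x. U n (f x)) has_derivative (\<lambda>h. U (Suc n) (f x) * D x h)) (at x)" for x
    using has_derivative_compose[OF D(1) compose.hyps(2)[unfolded has_field_derivative_def]] .
  moreover have "smooth_closure (\<lambda>x. U (Suc n) (f x) * D x (axis i 1))" for i
    by (rule smooth_closure.mult[OF smooth_closure.compose[where f = f and U = U and n = "Suc n"] D(2)])
      (use compose.hyps in auto)
  ultimately show ?case by (intro exI[of _ "\<lambda>x h. U (Suc n) (f x) * D x h"]) auto
qed

lemma smooth_closure_smooth3:
  assumes "smooth_closure f" shows "smooth3 f"
  using assms
proof (coinduction arbitrary: f)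
  case smooth3
  then obtain D where D: "\<And>x. (f has_derivative D x) (at x)" "\<And>i. smooth_closure (\<lambda>x. D x (axis i 1))"
    using smooth_closure_has_derivative by blast
  then have "frechet_derivative f (at x) = D x" for x
    using frechet_derivative_at by metis
  with D show ?case by (auto simp: differentiable_def)
qed

lemma smooth_closure_differentiable: "smooth_closure f \<Longrightarrow> f differentiable (at x)"
  using smooth_closure_has_derivative by (meson differentiable_def)

lemma smooth_closure_continuous_on: "smooth_closure f \<Longrightarrow> continuous_on S f"
  by (meson smooth_closure_differentiable continuous_at_imp_continuous_on differentiable_imp_continuous_within)

lemma has_derivative_grad3:
  assumes "f differentiable (at x)"
  shows "(f has_derivative (\<lambda>h. grad3 f x \<bullet> h)) (at x)"
proof -
  have "(f has_derivative frechet_derivative f (at x)) (at x)"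
    using assms by (simp add: frechet_derivative_works[symmetric])
  moreover have "frechet_derivative f (at x) = (\<lambda>h. grad3 f x \<bullet> h)"
  proof
    fix h
    have lin: "linear (frechet_derivative f (at x))"
      using assms by (rule linear_frechet_derivative)
    have "frechet_derivative f (at x) h = frechet_derivative f (at x) (\<Sum>i\<in>UNIV. h $ i *\<^sub>R axis i 1)"
      by (metis (no_types) basis_expansion scalar_mult_eq_scaleR)
    also have "\<dots> = (\<Sum>i\<in>UNIV. h $ i * frechet_derivative f (at x) (axis i 1))"
      using lin by (simp add: linear_sum linear_scale)
    also have "\<dots> = grad3 f x \<bullet> h" by (simp add: grad3_def inner_vec_def mult.commute)
    finally show "frechet_derivative f (at x) h = grad3 f x \<bullet> h" .
  qed
  ultimately show ?thesis by simp
qed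

lemmas smooth_closure_has_derivative_grad3 = has_derivative_grad3[OF smooth_closure_differentiable]

lemma grad3_eqI:
  assumes "(f has_derivative (\<lambda>h. v \<bullet> h)) (at x)" shows "grad3 f x = v"
  unfolding grad3_def frechet_derivative_at[OF assms, symmetric] vec_eq_iff
  by (simp add: inner_axis)

lemma smooth_closure_continuous_grad3:
  assumes "smooth_closure f" shows "continuous_on S (grad3 f)"
proof -
  obtain D where D: "\<And>x. (f has_derivative D x) (at x)" "\<And>i. smooth_closure (\<lambda>x. D x (axis i 1))"
    using smooth_closure_has_derivative[OF assms] by blast
  then have "frechet_derivative f (at x) = D x" for x
    using frechet_derivative_at by metis
  then have "grad3 f = (\<lambda>x. \<chi> i. D x (axis i 1))" by (simp add: grad3_def)
  then show ?thesis
    using D(2) by (auto intro!: continuous_on_vec_lambda smooth_closure_continuous_on)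
qed

lemma smooth_closure_coord: "smooth_closure (\<lambda>x. x $ i)"
  by (rule smooth_closure.linear) (rule bounded_linear_vec_nth)

lemma smooth_closure_scale: "smooth_closure f \<Longrightarrow> smooth_closure (\<lambda>x. c * f x)"
  by (intro smooth_closure.mult smooth_closure.const)

lemma smooth_closure_uminus: "smooth_closure f \<Longrightarrow> smooth_closure (\<lambda>x. - f x)"
  using smooth_closure_scale[of f "-1"] by simp

lemma smooth_closure_diff: "smooth_closure f \<Longrightarrow> smooth_closure g \<Longrightarrow> smooth_closure (\<lambda>x. f x - g x)"
  using smooth_closure.add[OF _ smooth_closure_uminus, of f g] by simp

lemma smooth_closure_norm_square: "smooth_closure (\<lambda>x. (norm x)\<^sup>2)"
proof -
  have "(\<lambda>x::real^3. (norm x)\<^sup>2) = (\<lambda>x. x $ 1 * x $ 1 + x $ 2 * x $ 2 + x $ 3 * x $ 3)"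
    by (simp add: power2_norm_eq_inner inner_vec_def sum_3)
  then show ?thesis by (auto intro!: smooth_closure.add smooth_closure.mult smooth_closure_coord)
qed

lemma smooth_closure_polynomial:
  assumes "real_polynomial_function p" shows "smooth_closure p"
  using assms
  by induction (auto intro: smooth_closure.linear smooth_closure.const smooth_closure.add smooth_closure.mult)

subsection \<open>Cutoff functions\<close>

text \<open>With y = 1/t, the derivative of p(y) exp(-y) with respect to t is y^2 (p(y) - p'(y))
  exp(-y), and \<open>[:0, 0, 1:]\<close> is y^2.\<close>

fun flat_poly :: "nat \<Rightarrow> real poly" where
  "flat_poly 0 = 1"
| "flat_poly (Suc n) = [:0, 0, 1:] * (flat_poly n - pderiv (flat_poly n))"

text \<open>The \<open>n\<close>-th derivative of \<open>exp (-1/t)\<close> for positive \<open>t\<close>, extended by \<open>0\<close>.\<close>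
definition flat_deriv :: "nat \<Rightarrow> real \<Rightarrow> real" where
  "flat_deriv n t = (if t > 0 then poly (flat_poly n) (1 / t) * exp (- (1 / t)) else 0)"

lemma poly_times_exp_minus_tendsto_0:
  fixes p :: "real poly"
  shows "((\<lambda>y. poly p y * exp (- y)) \<longlongrightarrow> 0) at_top"
proof -
  have "((\<lambda>y. \<Sum>i\<le>degree p. coeff p i * (y ^ i / exp y)) \<longlongrightarrow> (\<Sum>i\<le>degree p. coeff p i * 0)) at_top"
    by (intro tendsto_sum tendsto_mult tendsto_const tendsto_power_div_exp_0)
  then show ?thesis
    by (simp add: poly_altdef exp_minus divide_inverse sum_distrib_right mult.assoc)
qed

lemma flat_deriv_has_derivative:
  "(flat_deriv n has_real_derivative flat_deriv (Suc n) t) (at t)"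
proof -
  consider "t > 0" | "t < 0" | "t = 0" by linarith
  then show ?thesis
  proof cases
    case 1
    have "((\<lambda>t. poly (flat_poly n) (1 / t) * exp (- (1 / t))) has_real_derivative flat_deriv (Suc n) t) (at t)"
      using 1 by (auto intro!: derivative_eq_intros simp: flat_deriv_def power2_eq_square field_simps)
    then show ?thesis
      by (rule has_field_derivative_transform_within_open[where S = "{0<..}"])
        (use 1 in \<open>auto simp: flat_deriv_def\<close>)
  next
    case 2
    have "((\<lambda>t. 0) has_real_derivative flat_deriv (Suc n) t) (at t)"
      using 2 by (simp add: flat_deriv_def)
    then show ?thesis
      by (rule has_field_derivative_transform_within_open[where S = "{..<0}"])
        (use 2 in \<open>auto simp: flat_deriv_def\<close>)
  next
    case 3
    have "((\<lambda>h. flat_deriv n h / h) \<longlongrightarrow> 0) (at_left 0)"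
      by (rule tendsto_eventually) (auto simp: flat_deriv_def eventually_at_filter)
    moreover have "((\<lambda>h. flat_deriv n h / h) \<longlongrightarrow> 0) (at_right 0)"
    proof -
      \<comment> \<open>Dividing by h = 1/y multiplies the polynomial by y, hence the extra
        \<open>pCons 0\<close>; the exponential still wins.\<close>
      have "((\<lambda>h. poly (pCons 0 (flat_poly n)) (inverse h) * exp (- inverse h)) \<longlongrightarrow> 0) (at_right 0)"
        by (rule filterlim_compose[OF poly_times_exp_minus_tendsto_0 filterlim_inverse_at_top_right])
      then show ?thesis
        by (rule Lim_transform_eventually)
          (auto simp: flat_deriv_def eventually_at_filter divide_inverse mult_ac)
    qed
    ultimately have "((\<lambda>h. flat_deriv n h / h) \<longlongrightarrow> 0) (at 0)"
      by (rule filterlim_split_at)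
    then show ?thesis using 3 by (simp add: DERIV_def flat_deriv_def)
  qed
qed

definition cutoff :: "real \<Rightarrow> real" where
  "cutoff t = flat_deriv 0 (2 - t) * inverse (flat_deriv 0 (2 - t) + flat_deriv 0 (t - 1))"

text \<open>The arguments \<open>2 - t\<close> and \<open>t - 1\<close> add up to 1, so at least one
  of them is positive.\<close>

lemma cutoff_denominator_pos: "flat_deriv 0 (2 - t) + flat_deriv 0 (t - 1) > 0"
  by (cases "t < 2") (auto simp: flat_deriv_def intro: add_pos_nonneg)

lemma cutoff_eq_1: "t \<le> 1 \<Longrightarrow> cutoff t = 1"
  by (simp add: cutoff_def flat_deriv_def)

lemma cutoff_eq_0: "t \<ge> 2 \<Longrightarrow> cutoff t = 0"
  by (simp add: cutoff_def flat_deriv_def)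

lemma cutoff_nonneg: "cutoff t \<ge> 0"
  using cutoff_denominator_pos[of t] by (simp add: cutoff_def flat_deriv_def)

lemma cutoff_le_1: "cutoff t \<le> 1"
  using cutoff_denominator_pos[of t]
  by (simp add: cutoff_def flat_deriv_def field_simps)

lemma smooth_closure_cutoff:
  assumes "smooth_closure q" shows "smooth_closure (\<lambda>x. cutoff (q x))"
proof -
  have flat: "smooth_closure (\<lambda>x. flat_deriv 0 (f x))" if "smooth_closure f" for f
    by (rule smooth_closure.compose[where U = flat_deriv and f = f and n = 0])
      (auto intro: that flat_deriv_has_derivative)
  show ?thesis unfolding cutoff_def
    by (intro smooth_closure.mult smooth_closure.inverse smooth_closure.add flat smooth_closure_diff
        smooth_closure.const assms less_imp_neq[OF cutoff_denominator_pos, symmetric])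
qed

section \<open>Currents of finite mass\<close>

lemma integrable_inner_current:
  fixes B \<tau> :: "real^3 \<Rightarrow> real^3"
  assumes "finite_measure \<mu>" "sets \<mu> = sets (restrict_space borel (cball 0 R))"
    "\<tau> \<in> borel_measurable \<mu>" "\<And>x. norm (\<tau> x) = 1" "continuous_on (cball 0 R) B"
  shows "integrable \<mu> (\<lambda>x. B x \<bullet> \<tau> x)"
proof -
  have sp: "space \<mu> = cball 0 R"
    using sets_eq_imp_space_eq[OF assms(2)] by (simp add: space_restrict_space)
  have [measurable]: "B \<in> borel_measurable \<mu>"
    using borel_measurable_continuous_on_restrict[OF assms(5)] measurable_cong_sets[OF assms(2) refl] by blast
  note assms(3)[measurable]
  obtain K where K: "\<And>x. x \<in> cball 0 R \<Longrightarrow> norm (B x) \<le> K"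
    using compact_imp_bounded[OF compact_continuous_image[OF assms(5) compact_cball]]
    unfolding bounded_iff by blast
  show ?thesis
  proof (rule finite_measure.integrable_const_bound[OF assms(1), where B = K])
    show "AE x in \<mu>. norm (B x \<bullet> \<tau> x) \<le> K"
    proof (rule AE_I2)
      fix x assume "x \<in> space \<mu>"
      then show "norm (B x \<bullet> \<tau> x) \<le> K"
        using Cauchy_Schwarz_ineq2[of "B x" "\<tau> x"] assms(4)[of x] K[of x] by (simp add: sp)
    qed
  qed measurable
qed

lemma current_add:
  assumes "finite_mass_current R T" "continuous_on (cball 0 R) A" "continuous_on (cball 0 R) B"
  shows "T (\<lambda>x. A x + B x) = T A + T B"
proof -
  obtain \<mu> \<tau> where *: "finite_measure \<mu>" "sets \<mu> = sets (restrict_space borel (cball 0 R))"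
    "\<tau> \<in> borel_measurable \<mu>" "\<And>x. norm (\<tau> x) = 1"
    and T: "\<And>B. continuous_on (cball 0 R) B \<Longrightarrow> T B = (\<integral>x. B x \<bullet> \<tau> x \<partial>\<mu>)"
    using assms(1) unfolding finite_mass_current_def by blast
  note int = integrable_inner_current[OF *]
  show ?thesis
    using int[OF assms(2)] int[OF assms(3)] assms
    by (simp add: T continuous_on_add inner_add_left)
qed

lemma current_scale:
  assumes "finite_mass_current R T" "continuous_on (cball 0 R) B"
  shows "T (\<lambda>x. c *\<^sub>R B x) = c * T B"
proof -
  obtain \<mu> \<tau> where T: "\<And>B. continuous_on (cball 0 R) B \<Longrightarrow> T B = (\<integral>x. B x \<bullet> \<tau> x \<partial>(\<mu> :: (real^3) measure))"
    using assms(1) unfolding finite_mass_current_def by blast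
  show ?thesis using assms by (simp add: T continuous_on_scaleR continuous_on_const)
qed

lemma current_diff:
  assumes "finite_mass_current R T" "continuous_on (cball 0 R) A" "continuous_on (cball 0 R) B"
  shows "T (\<lambda>x. A x - B x) = T A - T B"
  using current_add[OF assms(1,2), of "\<lambda>x. (-1) *\<^sub>R B x"] current_scale[OF assms(1,3), of "-1"] assms
  by (simp add: continuous_on_minus)

lemma current_minus:
  assumes "finite_mass_current R T" "continuous_on (cball 0 R) B"
  shows "T (\<lambda>x. - B x) = - T B"
  using current_scale[OF assms, of "-1"] by simp

lemma current_cong:
  assumes "finite_mass_current R T" "continuous_on (cball 0 R) A" "\<And>x. x \<in> cball 0 R \<Longrightarrow> A x = B x"
  shows "T A = T B"
proof -
  obtain \<mu> \<tau> where sets: "sets \<mu> = sets (restrict_space borel (cball 0 R))"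
    and T: "\<And>B. continuous_on (cball 0 R) B \<Longrightarrow> T B = (\<integral>x. B x \<bullet> \<tau> x \<partial>(\<mu> :: (real^3) measure))"
    using assms(1) unfolding finite_mass_current_def by blast
  have "space \<mu> = cball 0 R"
    using sets_eq_imp_space_eq[OF sets] by (simp add: space_restrict_space)
  moreover have "continuous_on (cball 0 R) B"
    by (rule continuous_on_eq[OF assms(2,3)])
  ultimately show ?thesis
    unfolding T[OF assms(2)] T[OF \<open>continuous_on (cball 0 R) B\<close>]
    using assms(3) by (intro Bochner_Integration.integral_cong) auto
qed

text \<open>The total measure of the representing \<mu> gives a crude bound for all continuous
  fields. It controls approximation errors before the sharp bound by \<open>mass\<close> is
  available.\<close>

lemma current_bounded:
  assumes "finite_mass_current R T"
  obtains M where "M \<ge> 0" "\<And>B K. continuous_on (cball 0 R) B \<Longrightarrow> (\<And>x. x \<in> cball 0 R \<Longrightarrow> norm (B x) \<le> K) \<Longrightarrow> T B \<le> K * M"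
proof -
  obtain \<mu> \<tau> where *: "finite_measure \<mu>" "sets \<mu> = sets (restrict_space borel (cball 0 R))"
    "\<tau> \<in> borel_measurable \<mu>" "\<And>x. norm (\<tau> x) = 1"
    and T: "\<And>B. continuous_on (cball 0 R) B \<Longrightarrow> T B = (\<integral>x. B x \<bullet> \<tau> x \<partial>\<mu>)"
    using assms(1) unfolding finite_mass_current_def by blast
  have sp: "space \<mu> = cball 0 R"
    using sets_eq_imp_space_eq[OF *(2)] by (simp add: space_restrict_space)
  interpret finite_measure \<mu> by (rule *)
  have "T B \<le> K * measure \<mu> (space \<mu>)"
    if B: "continuous_on (cball 0 R) B" and K: "\<And>x. x \<in> cball 0 R \<Longrightarrow> norm (B x) \<le> K" for B K
  proof -
    have "T B \<le> (\<integral>x. K \<partial>\<mu>)"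
      unfolding T[OF B]
    proof (rule integral_mono[OF integrable_inner_current[OF * B]])
      fix x assume "x \<in> space \<mu>"
      then show "B x \<bullet> \<tau> x \<le> K"
        using Cauchy_Schwarz_ineq2[of "B x" "\<tau> x"] *(4)[of x] K[of x] by (simp add: sp)
    qed simp
    then show ?thesis by (simp add: mult.commute)
  qed
  then show thesis using that[of "measure \<mu> (space \<mu>)"] by simp
qed

lemma smooth3_continuous_on: "smooth3 f \<Longrightarrow> continuous_on S f"
  by (erule smooth3.cases)
    (meson continuous_at_imp_continuous_on differentiable_imp_continuous_within)

lemma test_form_continuous_on:
  assumes "test_form w" shows "continuous_on S w"
proof -
  have "continuous_on S (\<lambda>x. \<chi> i. w x $ i)"
    using assms by (intro continuous_on_vec_lambda smooth3_continuous_on) (simp add: test_form_def)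
  then show ?thesis by simp
qed

lemma test_form_zero: "test_form (\<lambda>x. 0)"
  by (simp add: test_form_def smooth_closure_smooth3 smooth_closure.const)

lemma bdd_above_test_forms:
  assumes "finite_mass_current R T"
  shows "bdd_above (T ` {w. test_form w \<and> (\<forall>x. norm (w x) \<le> 1)})"
proof -
  obtain M where M: "M \<ge> 0" "\<And>B K. continuous_on (cball 0 R) B \<Longrightarrow> (\<And>x. x \<in> cball 0 R \<Longrightarrow> norm (B x) \<le> K) \<Longrightarrow> T B \<le> K * M"
    using current_bounded[OF assms] by blast
  show ?thesis
    by (rule bdd_aboveI2[where M = "1 * M"]) (rule M(2), auto intro!: test_form_continuous_on)
qed

lemma mass_nonneg:
  assumes "finite_mass_current R T" shows "mass T \<ge> 0"
proof -
  have "T (\<lambda>x. 0) = 0"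
    using current_scale[OF assms continuous_on_const, where c = 0] by simp
  then have "0 = T (\<lambda>x. 0)" by simp
  also have "\<dots> \<le> mass T" unfolding mass_def
    by (rule cSUP_upper[OF _ bdd_above_test_forms[OF assms]]) (simp add: test_form_zero)
  finally show ?thesis .
qed

lemma compact_closure_nonzero:
  fixes f :: "real^3 \<Rightarrow> 'b::zero"
  assumes "\<And>x. f x \<noteq> 0 \<Longrightarrow> norm x \<le> r"
  shows "compact (closure {x. f x \<noteq> 0})"
proof -
  have "{x. f x \<noteq> 0} \<subseteq> cball 0 r" using assms by auto
  then show ?thesis by (meson bounded_cball bounded_subset compact_closure)
qed

text \<open>Continuous fields are approximated by admissible test forms: extend, approximate by
  polynomials, cut off, and renormalise. The error vanishes in the limit by
  \<open>current_bounded\<close>.\<close>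

lemma current_le_mass:
  assumes T: "finite_mass_current R T" and R: "R > 0" and w: "continuous_on (cball 0 R) w"
    and w1: "\<And>x. x \<in> cball 0 R \<Longrightarrow> norm (w x) \<le> 1"
  shows "T w \<le> mass T"
proof -
  obtain M where M: "M \<ge> 0" "\<And>B K. continuous_on (cball 0 R) B \<Longrightarrow> (\<And>x. x \<in> cball 0 R \<Longrightarrow> norm (B x) \<le> K) \<Longrightarrow> T B \<le> K * M"
    using current_bounded[OF T] by blast
  \<comment> \<open>Composition with the nearest-point projection extends \<open>w\<close>
    continuously without raising its bound 1.\<close>
  define w' where "w' x = w (closest_point (cball 0 R) x)" for x
  have cp: "closest_point (cball 0 R) x \<in> cball (0::real^3) R" for x
    using R by (intro closest_point_in_set) auto
  have w'c: "continuous_on S w'" for S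
    unfolding w'_def using R
    by (intro continuous_on_compose2[OF w continuous_on_closest_point]) (use cp in auto)
  have w'eq: "w' x = w x" if "x \<in> cball 0 R" for x
    using that by (simp add: w'_def closest_point_self)
  have w'1: "norm (w' x) \<le> 1" for x unfolding w'_def by (rule w1[OF cp])
  have appr: "T w \<le> (1 + e) * mass T + e * M" if e: "e > 0" for e
  proof -
    obtain p where p: "polynomial_function p" and pe: "\<And>x. x \<in> cball 0 (2 * R) \<Longrightarrow> norm (w' x - p x) < e"
      using Stone_Weierstrass_polynomial_function[OF compact_cball w'c e] by metis
    define \<eta> where "\<eta> x = cutoff ((1 / R\<^sup>2) * (norm x)\<^sup>2)" for x :: "real^3"
    have \<eta>1: "\<eta> x = 1" if "x \<in> cball 0 R" for x
      using that R by (auto simp: \<eta>_def field_simps intro!: cutoff_eq_1 power_mono)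
    have \<eta>0: "\<eta> x = 0" if "norm x \<ge> 2 * R" for x
    proof -
      have "(2 * R)\<^sup>2 \<le> (norm x)\<^sup>2" using that R by (intro power_mono) auto
      then have "4 * R\<^sup>2 \<le> (norm x)\<^sup>2" by (simp add: power_mult_distrib)
      then have "2 * R\<^sup>2 \<le> (norm x)\<^sup>2" using zero_le_power2[of R] by linarith
      then show ?thesis unfolding \<eta>_def using R by (intro cutoff_eq_0) (simp add: field_simps)
    qed
    \<comment> \<open>Where the cutoff is nonzero the polynomial is within \<open>e\<close> of a
      field of norm at most 1; division by \<open>1 + e\<close> makes the form admissible.\<close>
    define v where "v x = (\<eta> x / (1 + e)) *\<^sub>R p x" for x
    have "test_form v" unfolding test_form_def
    proof
      have "smooth_closure (\<lambda>x. (1 / (1 + e)) * \<eta> x * (p x $ i))" for i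
      proof (intro smooth_closure.mult smooth_closure.const)
        show "smooth_closure \<eta>" unfolding \<eta>_def
          by (intro smooth_closure_cutoff smooth_closure_scale smooth_closure_norm_square)
        have "real_polynomial_function (\<lambda>x. p x \<bullet> axis i 1)"
          using p by (auto simp: polynomial_function_iff_Basis_inner Basis_vec_def)
        then show "smooth_closure (\<lambda>x. p x $ i)"
          using smooth_closure_polynomial by (simp add: inner_axis)
      qed
      then show "\<forall>i. smooth3 (\<lambda>x. v x $ i)"
        by (intro allI smooth_closure_smooth3) (simp add: v_def)
      show "compact (closure {x. v x \<noteq> 0})"
        by (rule compact_closure_nonzero[where r = "2 * R"]) (use \<eta>0 in \<open>force simp: v_def\<close>)
    qed
    moreover have "norm (v x) \<le> 1" for x
    proof (cases "norm x \<le> 2 * R")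
      case True
      then have "norm (p x) \<le> 1 + e" using pe[of x] w'1[of x] norm_triangle_sub[of "p x" "w' x"]
        by (simp add: norm_minus_commute)
      then have "\<eta> x * norm (p x) \<le> 1 * (1 + e)"
        using e unfolding \<eta>_def by (intro mult_mono) (auto simp: cutoff_nonneg cutoff_le_1)
      then show ?thesis using e by (simp add: v_def \<eta>_def cutoff_nonneg field_simps)
    next
      case False
      then show ?thesis using \<eta>0[of x] by (simp add: v_def)
    qed
    ultimately have "T v \<le> mass T"
      unfolding mass_def by (intro cSUP_upper bdd_above_test_forms[OF T]) auto
    have vc: "continuous_on S v" for S by (rule test_form_continuous_on) fact
    have "T w - (1 + e) * T v = T (\<lambda>x. w x - (1 + e) *\<^sub>R v x)"
      using w vc by (simp add: current_diff[OF T] current_scale[OF T] continuous_on_scaleR continuous_on_const)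
    also have "\<dots> \<le> e * M"
    proof (rule M(2))
      show "continuous_on (cball 0 R) (\<lambda>x. w x - (1 + e) *\<^sub>R v x)"
        using w vc by (intro continuous_intros)
      fix x :: "real^3" assume x: "x \<in> cball 0 R"
      then have "w x - (1 + e) *\<^sub>R v x = w' x - p x" using e by (simp add: v_def \<eta>1 w'eq)
      moreover have "x \<in> cball 0 (2 * R)" using x R by simp
      ultimately show "norm (w x - (1 + e) *\<^sub>R v x) \<le> e" using pe[of x] by simp
    qed
    finally have "T w \<le> (1 + e) * T v + e * M" by simp
    also have "\<dots> \<le> (1 + e) * mass T + e * M"
      using \<open>T v \<le> mass T\<close> e by (intro add_right_mono mult_left_mono) auto
    finally show ?thesis .
  qed
  have le: "T w - mass T \<le> e * (mass T + M)" if "e > 0" for e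
    using appr[OF that] by (simp add: algebra_simps)
  have "((\<lambda>e. e * (mass T + M)) \<longlongrightarrow> 0 * (mass T + M)) (at_right 0)"
    by (intro tendsto_intros)
  then have "T w - mass T \<le> 0 * (mass T + M)"
    by (rule tendsto_lowerbound) (auto simp: eventually_at_filter le)
  then show ?thesis by simp
qed

lemma current_le_mass_scaled:
  assumes T: "finite_mass_current R T" and R: "R > 0" and w: "continuous_on (cball 0 R) w"
    and K: "K > 0" "\<And>x. x \<in> cball 0 R \<Longrightarrow> norm (w x) \<le> K"
  shows "T w \<le> K * mass T"
proof -
  have "T (\<lambda>x. (1 / K) *\<^sub>R w x) \<le> mass T"
    using K by (intro current_le_mass[OF T R]) (auto intro!: continuous_intros w simp: field_simps)
  then show ?thesis using K by (simp add: current_scale[OF T w] field_simps)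
qed

text \<open>Split \<open>f\<close> into a part supported off the sphere and a part supported near it. The latter is
  uniformly small, so its gradient is small on a current with finite boundary mass.\<close>
lemma normal_current_gradient_eq_0:
  assumes T: "T \<in> normal_currents R" and R: "R > 0" and f: "smooth_closure f"
    and f0: "\<And>x. x \<in> sphere 0 R \<Longrightarrow> f x = 0"
  shows "T (grad3 f) = 0"
proof -
  have fin: "finite_mass_current R T" using T by (simp add: normal_currents_def)
  obtain M0 where M0: "\<And>f. test_fn f \<Longrightarrow> (\<And>x. \<bar>f x\<bar> \<le> 1) \<Longrightarrow> T (grad3 f) \<le> M0"
    using T unfolding normal_currents_def by blast
  have T0: "T (grad3 f) = 0" if "test_fn f" "closure {x. f x \<noteq> 0} \<inter> sphere 0 R = {}" for f
    using T that unfolding normal_currents_def by blast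
  define M where "M = max M0 0"
  have le: "T (grad3 f) \<le> e * M"
    if f: "smooth_closure f" and f0: "\<And>x. x \<in> sphere 0 R \<Longrightarrow> f x = 0" and e: "e > 0" for f e
  proof -
    obtain d where d: "0 < d" and df: "\<And>x. \<bar>(norm x)\<^sup>2 - R\<^sup>2\<bar> < d \<Longrightarrow> \<bar>f x\<bar> \<le> e"
    proof -
      \<comment> \<open>The set where |f| is at least \<open>e\<close>, inside a larger ball, is
        compact and misses the sphere, so the squared norm stays a definite amount away from R^2 on
        it. Taking \<open>min d 1\<close> below keeps the shell inside that larger ball.\<close>
      define K where "K = cball 0 (R + 1) \<inter> {x. \<bar>f x\<bar> \<ge> e}"
      have "closed {x. \<bar>f x\<bar> \<ge> e}"
        using smooth_closure_continuous_on[OF f, of UNIV] by (intro closed_Collect_le continuous_intros) auto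
      then have "compact K" unfolding K_def by (intro compact_Int_closed compact_cball)
      define \<phi> where "\<phi> x = \<bar>(norm x)\<^sup>2 - R\<^sup>2\<bar>" for x :: "real^3"
      have pos: "\<phi> x > 0" if "x \<in> K" for x
        using f0[of x] that e R norm_ge_zero[of x] unfolding \<phi>_def K_def
        by (auto simp: power2_eq_iff simp del: norm_ge_zero)
      have "\<exists>d>0. \<forall>x\<in>K. d \<le> \<phi> x"
      proof (cases "K = {}")
        case False
        have "continuous_on K \<phi>" unfolding \<phi>_def by (intro continuous_intros)
        from continuous_attains_inf[OF \<open>compact K\<close> False this] pos show ?thesis by blast
      qed (auto intro: exI[of _ 1])
      then obtain d where d: "d > 0" "\<And>x. x \<in> K \<Longrightarrow> d \<le> \<phi> x" by blast
      show thesis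
      proof (rule that[of "min d 1"])
        fix x :: "real^3" assume x: "\<bar>(norm x)\<^sup>2 - R\<^sup>2\<bar> < min d 1"
        have "norm x \<le> R + 1"
        proof (rule power2_le_imp_le)
          show "(norm x)\<^sup>2 \<le> (R + 1)\<^sup>2" using x R unfolding power2_sum by auto
        qed (use R in simp)
        then show "\<bar>f x\<bar> \<le> e" using d(2)[of x] x by (force simp: K_def \<phi>_def)
      qed (use d in simp)
    qed
    \<comment> \<open>Squaring keeps \<open>q\<close> smooth. \<open>cutoff (q x)\<close> is 1 near
      the sphere and 0 once the squared norm differs from R^2 by at least \<open>d\<close>.\<close>
    define q where "q x = (2 / d\<^sup>2) * (((norm x)\<^sup>2 - R\<^sup>2) * ((norm x)\<^sup>2 - R\<^sup>2))" for x :: "real^3"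
    have qs: "smooth_closure q" unfolding q_def
      by (intro smooth_closure_scale smooth_closure.mult smooth_closure_diff smooth_closure_norm_square
          smooth_closure.const)
    define \<psi> where "\<psi> x = cutoff (q x)" for x
    have \<psi>s: "smooth_closure \<psi>" unfolding \<psi>_def by (rule smooth_closure_cutoff[OF qs])
    \<comment> \<open>Provides compact support while being 1 on an open neighbourhood of the ball,
      so gradients on the ball are unchanged.\<close>
    define \<eta> where "\<eta> x = cutoff ((1 / (R\<^sup>2 + 1)) * (norm x)\<^sup>2)" for x :: "real^3"
    have \<eta>s: "smooth_closure \<eta>" unfolding \<eta>_def
      by (intro smooth_closure_cutoff smooth_closure_scale smooth_closure_norm_square)
    have R1: "R\<^sup>2 + 1 > 0" using zero_le_power2[of R] by linarith
    have \<eta>1: "\<eta> x = 1" if "(norm x)\<^sup>2 < R\<^sup>2 + 1" for x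
      unfolding \<eta>_def using that R1 by (intro cutoff_eq_1) (simp add: pos_divide_le_eq)
    have \<eta>0: "norm x \<le> 2 * (R + 1)" if "\<eta> x \<noteq> 0" for x
    proof (rule power2_le_imp_le)
      have "(1 / (R\<^sup>2 + 1)) * (norm x)\<^sup>2 < 2"
        using that cutoff_eq_0 unfolding \<eta>_def by (meson not_le)
      then have "(norm x)\<^sup>2 < 2 * (R\<^sup>2 + 1)"
        using R1 by (simp add: pos_divide_less_eq)
      also have "\<dots> \<le> (2 * (R + 1))\<^sup>2"
        using R by (simp add: power2_eq_square algebra_simps)
      finally show "(norm x)\<^sup>2 \<le> (2 * (R + 1))\<^sup>2" by simp
    qed (use R in simp)
    define u where "u x = (f x * \<eta> x) * \<psi> x" for x
    define v where "v x = (f x * \<eta> x) * (1 - \<psi> x)" for x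
    have us: "smooth_closure u" unfolding u_def by (intro smooth_closure.mult f \<eta>s \<psi>s)
    have vs: "smooth_closure v" unfolding v_def
      by (intro smooth_closure.mult smooth_closure_diff smooth_closure.const f \<eta>s \<psi>s)
    have tu: "test_fn u" unfolding test_fn_def
      by (intro conjI smooth_closure_smooth3 us compact_closure_nonzero[where r = "2 * (R + 1)"])
        (auto simp: u_def dest: \<eta>0)
    have tv: "test_fn v" unfolding test_fn_def
      by (intro conjI smooth_closure_smooth3 vs compact_closure_nonzero[where r = "2 * (R + 1)"])
        (auto simp: v_def dest: \<eta>0)
    have "T (grad3 v) = 0"
    proof (rule T0[OF tv])
      have "q x \<ge> 1" if "v x \<noteq> 0" for x
        using that cutoff_eq_1[of "q x"] by (force simp: v_def \<psi>_def)
      then have "{x. v x \<noteq> 0} \<subseteq> {x. 1 \<le> q x}" by auto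
      moreover have "closed {x. 1 \<le> q x}"
        using smooth_closure_continuous_on[OF qs, of UNIV] by (intro closed_Collect_le continuous_intros) auto
      ultimately have "closure {x. v x \<noteq> 0} \<subseteq> {x. 1 \<le> q x}" by (rule closure_minimal)
      then show "closure {x. v x \<noteq> 0} \<inter> sphere 0 R = {}" by (auto simp: q_def)
    qed
    have ue: "\<bar>u x\<bar> \<le> e" for x
    proof (cases "q x < 2")
      case True
      then have "((norm x)\<^sup>2 - R\<^sup>2)\<^sup>2 < d\<^sup>2"
        using d by (simp add: q_def power2_eq_square field_simps)
      then have "\<bar>(norm x)\<^sup>2 - R\<^sup>2\<bar> < d"
        using d abs_le_square_iff[of d "(norm x)\<^sup>2 - R\<^sup>2"] by linarith
      then have "\<bar>f x\<bar> \<le> e" by (rule df)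
      then have "\<bar>f x\<bar> * \<bar>\<eta> x\<bar> * \<bar>\<psi> x\<bar> \<le> e * 1 * 1"
        using e by (intro mult_mono) (auto simp: \<eta>_def \<psi>_def cutoff_le_1 cutoff_nonneg)
      then show ?thesis by (simp add: u_def abs_mult)
    next
      case False
      then show ?thesis using cutoff_eq_0[of "q x"] e by (simp add: u_def \<psi>_def)
    qed
    \<comment> \<open>The boundary bound \<open>M0\<close> applies to functions of size at most 1;
      rescaling turns |u| \<le> e into a contribution of at most \<open>e * M0\<close>.\<close>
    define u' where "u' x = (1 / e) * u x" for x
    have u's: "smooth_closure u'" unfolding u'_def by (rule smooth_closure_scale[OF us])
    have tu': "test_fn u'" unfolding test_fn_def
      by (intro conjI smooth_closure_smooth3 u's compact_closure_nonzero[where r = "2 * (R + 1)"])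
        (auto simp: u'_def u_def dest: \<eta>0)
    have "T (grad3 u') \<le> M0"
      by (rule M0[OF tu']) (use ue e in \<open>simp add: u'_def field_simps\<close>)
    have grad_f: "grad3 f x = grad3 v x + e *\<^sub>R grad3 u' x" if x: "x \<in> cball 0 R" for x
    proof (rule grad3_eqI)
      have "((\<lambda>x. v x + e * u' x) has_derivative (\<lambda>h. grad3 v x \<bullet> h + e * (grad3 u' x \<bullet> h))) (at x)"
        by (intro has_derivative_add has_derivative_mult_right smooth_closure_has_derivative_grad3 vs u's)
      moreover have "open {x::real^3. (norm x)\<^sup>2 < R\<^sup>2 + 1}"
        by (intro open_Collect_less continuous_intros)
      moreover have "x \<in> {x. (norm x)\<^sup>2 < R\<^sup>2 + 1}"
      proof -
        have "(norm x)\<^sup>2 \<le> R\<^sup>2" using x by (intro power_mono) auto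
        then show ?thesis by simp
      qed
      ultimately have "(f has_derivative (\<lambda>h. grad3 v x \<bullet> h + e * (grad3 u' x \<bullet> h))) (at x)"
        by (rule has_derivative_transform_within_open)
          (use e in \<open>auto simp: v_def u'_def u_def \<eta>1 algebra_simps\<close>)
      then show "(f has_derivative (\<lambda>h. (grad3 v x + e *\<^sub>R grad3 u' x) \<bullet> h)) (at x)"
        by (simp add: inner_add_left)
    qed
    have "T (grad3 f) = T (\<lambda>x. grad3 v x + e *\<^sub>R grad3 u' x)"
      by (rule current_cong[OF fin smooth_closure_continuous_grad3[OF f] grad_f])
    also have "\<dots> = T (grad3 v) + e * T (grad3 u')"
      using smooth_closure_continuous_grad3[OF vs] smooth_closure_continuous_grad3[OF u's]
      by (simp add: current_add[OF fin] current_scale[OF fin] continuous_on_scaleR continuous_on_const)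
    also have "\<dots> \<le> e * M"
      using \<open>T (grad3 v) = 0\<close> \<open>T (grad3 u') \<le> M0\<close> e by (auto simp: M_def)
    finally show ?thesis .
  qed
  have nonpos: "T (grad3 f) \<le> 0" if "smooth_closure f" "\<And>x. x \<in> sphere 0 R \<Longrightarrow> f x = 0" for f
  proof -
    have "((\<lambda>e. e * M) \<longlongrightarrow> 0 * M) (at_right 0)" by (intro tendsto_intros)
    then have "T (grad3 f) \<le> 0 * M"
      by (rule tendsto_lowerbound) (auto intro!: eventually_mono[OF eventually_at_right_less[of 0]] le that)
    then show ?thesis by simp
  qed
  have "grad3 (\<lambda>x. - f x) = (\<lambda>x. - grad3 f x)"
    using has_derivative_minus[OF smooth_closure_has_derivative_grad3[OF f]]
    by (intro ext grad3_eqI) (simp add: inner_minus_left)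
  then have "- T (grad3 f) \<le> 0"
    using nonpos[OF smooth_closure_uminus[OF f]] f0
    by (simp add: current_minus[OF fin smooth_closure_continuous_grad3[OF f]])
  with nonpos[OF f f0] show ?thesis by simp
qed

section \<open>The calibration\<close>

lemma norm_square_3: "(norm x)\<^sup>2 = (x $ 1)\<^sup>2 + (x $ 2)\<^sup>2 + (x $ 3)\<^sup>2" for x :: "real^3"
  unfolding power2_norm_eq_inner by (simp add: inner_vec_def sum_3 power2_eq_square)

text \<open>With \<open>A(s) = pot 0 s\<close>, \<open>A + 2 s A'\<close> is the radial profile \<open>(cosh r - sinh r / r) / r\<^sup>2\<close> at
  \<open>s = r\<^sup>2\<close>; equivalently \<open>A\<close> is the mean of that profile over \<open>[0, r]\<close>, which has no elementary form.
  \<open>pot n\<close> is the \<open>n\<close>-th derivative of \<open>A\<close>.\<close>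
definition pot_coeff :: "nat \<Rightarrow> real" where
  "pot_coeff k = 2 * (real k + 1) / ((2 * real k + 1) * fact (2 * k + 3))"

definition pot :: "nat \<Rightarrow> real \<Rightarrow> real" where
  "pot n s = (\<Sum>k. (diffs ^^ n) pot_coeff k * s ^ k)"

lemma pot_coeff_le: "pot_coeff k \<le> 1 / fact k"
proof -
  have "2 * (real k + 1) \<le> real (2 * k + 3) * (2 * real k + 1)" by (simp add: algebra_simps)
  also have "\<dots> = real (2 * k + 3) * (2 * real k + 1) * 1" by simp
  also have "\<dots> \<le> real (2 * k + 3) * (2 * real k + 1) * (fact (2 * k + 2) / fact k)"
  proof (rule mult_left_mono)
    have "(fact k :: real) \<le> fact (2 * k + 2)" by (rule fact_mono) simp
    then show "1 \<le> (fact (2 * k + 2) :: real) / fact k" by (simp only: le_divide_eq_1_pos fact_gt_zero)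
  qed simp
  also have "\<dots> = (2 * real k + 1) * fact (2 * k + 3) / fact k"
    by (simp add: eval_nat_numeral)
  finally have "2 * (real k + 1) \<le> (2 * real k + 1) * fact (2 * k + 3) / fact k" .
  moreover have "(2 * real k + 1) * fact (2 * k + 3) > 0" by simp
  ultimately show ?thesis by (simp only: pot_coeff_def pos_divide_le_eq times_divide_eq_left mult_1_left)
qed

lemma summable_pot: "summable (\<lambda>k. (diffs ^^ n) pot_coeff k * s ^ k)"
proof (induction n arbitrary: s)
  case 0
  show ?case
  proof (rule summable_comparison_test'[where N = 0])
    show "summable (\<lambda>k. inverse (fact k) * \<bar>s\<bar> ^ k)" by (rule summable_exp)
    show "norm ((diffs ^^ 0) pot_coeff k * s ^ k) \<le> inverse (fact k) * \<bar>s\<bar> ^ k" for k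
    proof -
      have "norm ((diffs ^^ 0) pot_coeff k * s ^ k) = pot_coeff k * \<bar>s\<bar> ^ k"
        by (simp add: abs_mult power_abs pot_coeff_def)
      also have "\<dots> \<le> inverse (fact k) * \<bar>s\<bar> ^ k"
        using pot_coeff_le[of k] by (intro mult_right_mono) (auto simp: inverse_eq_divide)
      finally show ?thesis .
    qed
  qed
next
  case (Suc n)
  show ?case using termdiff_converges_all[of "(diffs ^^ n) pot_coeff", OF Suc.IH] by simp
qed

lemma pot_has_derivative: "(pot n has_real_derivative pot (Suc n) t) (at t)"
  unfolding pot_def[abs_def]
  using termdiffs_strong_converges_everywhere[OF summable_pot, of n t] by simp

lemma diffs_pot_coeff_pos: "(diffs ^^ n) pot_coeff k > 0"
proof (induction n arbitrary: k)
  case 0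
  show ?case by (simp add: pot_coeff_def)
qed (simp add: diffs_def)

lemma pot_mono: "0 \<le> s \<Longrightarrow> s \<le> t \<Longrightarrow> pot n s \<le> pot n t"
  unfolding pot_def
  by (intro suminf_le summable_pot mult_left_mono power_mono) (auto intro: less_imp_le diffs_pot_coeff_pos)

lemma pot_0: "pot n 0 = (diffs ^^ n) pot_coeff 0"
  unfolding pot_def using powser_zero[of "(diffs ^^ n) pot_coeff"] by simp

lemma pot_pos: "0 \<le> s \<Longrightarrow> pot n s > 0"
  using pot_mono[of 0 s n] diffs_pot_coeff_pos[of n 0] by (simp add: pot_0)

text \<open>The left side is the sum of 2k s^k / (2k+1)! with s = r^2; its term k = 0 vanishes,
  which gives the factor \<open>r\<^sup>2\<close> after a shift. Passing from A to A + 2 s A'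
  multiplies the k-th coefficient by 2k+1, which the denominator of \<open>pot_coeff\<close>
  compensates.\<close>

lemma cosh_minus_sinh_div_eq_pot:
  assumes "r > 0"
  shows "cosh r - sinh r / r = r\<^sup>2 * (pot 0 (r\<^sup>2) + 2 * r\<^sup>2 * pot 1 (r\<^sup>2))"
proof -
  define s where "s = r\<^sup>2"
  have "(\<lambda>k. r ^ (2 * k) / fact (2 * k)) sums cosh r"
  proof -
    have "(\<lambda>k. (\<lambda>n. if even n then r ^ n /\<^sub>R fact n else 0) (2 * k)) sums cosh r"
      using cosh_converges[of r] by (subst sums_mono_reindex) (auto simp: strict_mono_def image_iff elim: evenE)
    then show ?thesis by (simp add: divide_inverse mult.commute)
  qed
  moreover have "(\<lambda>k. r ^ (2 * k) / fact (2 * k + 1)) sums (sinh r / r)"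
  proof -
    have "(\<lambda>k. (\<lambda>n. if even n then 0 else r ^ n /\<^sub>R fact n) (2 * k + 1)) sums sinh r"
      using sinh_converges[of r] by (subst sums_mono_reindex) (auto simp: strict_mono_def image_iff elim: oddE)
    then have "(\<lambda>k. r ^ (2 * k + 1) /\<^sub>R fact (2 * k + 1)) sums sinh r" by simp
    moreover have "(r ^ (2 * k + 1) /\<^sub>R fact (2 * k + 1)) / r = r ^ (2 * k) / fact (2 * k + 1)" for k
      using assms by (simp add: field_simps del: fact_Suc)
    ultimately show ?thesis using sums_divide[of _ "sinh r" r] by (metis (no_types, lifting) sums_cong)
  qed
  ultimately have "(\<lambda>k. r ^ (2 * k) / fact (2 * k) - r ^ (2 * k) / fact (2 * k + 1)) sums (cosh r - sinh r / r)"
    by (rule sums_diff)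
  moreover have "r ^ (2 * k) / fact (2 * k) - r ^ (2 * k) / fact (2 * k + 1) = 2 * real k / fact (2 * k + 1) * s ^ k" for k
  proof -
    have "r ^ (2 * k) = s ^ k" by (simp add: s_def power_mult)
    moreover have "X / a - X / (b * a) = (b - 1) / (b * a) * X" if "a > 0" "b > 0" for X a b :: real
      using that by (simp add: field_simps)
    from this[of "fact (2 * k)" "2 * real k + 1" "s ^ k"]
    have "s ^ k / fact (2 * k) - s ^ k / fact (2 * k + 1) = 2 * real k / fact (2 * k + 1) * s ^ k"
      by (simp add: add.commute)
    ultimately show ?thesis by (simp only:)
  qed
  ultimately have "(\<lambda>k. 2 * real k / fact (2 * k + 1) * s ^ k) sums (cosh r - sinh r / r)" by simp
  then have 1: "(\<lambda>k. 2 * real (Suc k) / fact (2 * Suc k + 1) * s ^ Suc k) sums (cosh r - sinh r / r)"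
    by (subst sums_Suc_iff) simp
  have "(\<lambda>k. pot_coeff k * s ^ k) sums pot 0 s"
    using summable_sums[OF summable_pot[of 0 s]] by (simp add: pot_def)
  moreover have "(\<lambda>k. real k * pot_coeff k * s ^ (k - Suc 0)) sums pot 1 s"
    using diffs_equiv[of pot_coeff s] summable_pot[of 1 s] by (simp add: pot_def)
  ultimately have "(\<lambda>k. s * (pot_coeff k * s ^ k + 2 * s * (real k * pot_coeff k * s ^ (k - Suc 0)))) sums
      (s * (pot 0 s + 2 * s * pot 1 s))"
    by (intro sums_mult sums_add)
  moreover have "s * (pot_coeff k * s ^ k + 2 * s * (real k * pot_coeff k * s ^ (k - Suc 0)))
      = 2 * real (Suc k) / fact (2 * Suc k + 1) * s ^ Suc k" for k
  proof -
    have "s * (pot_coeff k * s ^ k + 2 * s * (real k * pot_coeff k * s ^ (k - Suc 0)))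
        = (2 * real k + 1) * pot_coeff k * s ^ Suc k"
      by (cases k) (simp_all add: algebra_simps)
    also have "(2 * real k + 1) * pot_coeff k = 2 * real (Suc k) / fact (2 * k + 3)"
      by (simp add: pot_coeff_def add.commute del: fact_Suc)
    finally show ?thesis by (simp add: eval_nat_numeral)
  qed
  ultimately have "(\<lambda>k. 2 * real (Suc k) / fact (2 * Suc k + 1) * s ^ Suc k) sums (s * (pot 0 s + 2 * s * pot 1 s))"
    by simp
  with 1 show ?thesis using sums_unique2 unfolding s_def by blast
qed

text \<open>The left side is r times the derivative of cosh r - sinh r / r, so differentiating the
  previous identity replaces a second comparison of series.\<close>

lemma sinh_minus_cosh_eq_pot:
  assumes r: "r > 0"
  shows "(1 + r\<^sup>2) / r * sinh r - cosh r = 2 * r\<^sup>2 * (pot 0 (r\<^sup>2) + 5 * r\<^sup>2 * pot 1 (r\<^sup>2) + 2 * (r\<^sup>2)\<^sup>2 * pot 2 (r\<^sup>2))"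
proof -
  have pd: "(pot 0 has_real_derivative pot 1 t) (at t)" "(pot 1 has_real_derivative pot 2 t) (at t)" for t
    using pot_has_derivative[of 0 t] pot_has_derivative[of 1 t] by (simp_all add: numeral_2_eq_2)
  note chain = DERIV_chain2[OF pd(1)] DERIV_chain2[OF pd(2)]
  have "((\<lambda>r. r\<^sup>2 * (pot 0 (r\<^sup>2) + 2 * r\<^sup>2 * pot 1 (r\<^sup>2))) has_real_derivative
      2 * r * (pot 0 (r\<^sup>2) + 5 * r\<^sup>2 * pot 1 (r\<^sup>2) + 2 * (r\<^sup>2)\<^sup>2 * pot 2 (r\<^sup>2))) (at r)"
    by (rule derivative_eq_intros chain refl | simp)+ (simp add: algebra_simps power2_eq_square power4_eq_xxxx)
  then have "((\<lambda>r. cosh r - sinh r / r) has_real_derivative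
      2 * r * (pot 0 (r\<^sup>2) + 5 * r\<^sup>2 * pot 1 (r\<^sup>2) + 2 * (r\<^sup>2)\<^sup>2 * pot 2 (r\<^sup>2))) (at r)"
    by (rule has_field_derivative_transform_within_open[where S = "{0<..}"])
      (use r in \<open>auto simp: cosh_minus_sinh_div_eq_pot\<close>)
  moreover have "((\<lambda>r. cosh r - sinh r / r) has_real_derivative (sinh r - (cosh r * r - sinh r) / r\<^sup>2)) (at r)"
    using r by (auto intro!: derivative_eq_intros simp: power2_eq_square)
  ultimately have e1: "sinh r - (cosh r * r - sinh r) / r\<^sup>2 =
      2 * r * (pot 0 (r\<^sup>2) + 5 * r\<^sup>2 * pot 1 (r\<^sup>2) + 2 * (r\<^sup>2)\<^sup>2 * pot 2 (r\<^sup>2))"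
    using DERIV_unique by blast
  have e2: "(1 + r\<^sup>2) / r * sinh r - cosh r = r * (sinh r - (cosh r * r - sinh r) / r\<^sup>2)"
    using r by (simp add: field_simps power2_eq_square)
  show ?thesis unfolding e2 e1 by (simp only: power2_eq_square mult_ac)
qed

section \<open>The decomposition of the field\<close>

definition scal :: "real \<Rightarrow> real" where "scal R = 3 * R / sinh R"

text \<open>\<open>scal R * s * twist s\<close> is what remains of the polar-angle profile of
  \<open>B0 R\<close> after that of the gradient part is removed; the factor s is split off so that
  an entire function with positive coefficients is left.\<close>

definition twist :: "real \<Rightarrow> real" where "twist s = 5 * pot 1 s + 2 * s * pot 2 s"

text \<open>Equals \<open>C_R R - scal R * pot 0 (R\<^sup>2)\<close>, the constant vertical part
  left by the gradient. With this value \<open>cal_field R\<close> is normal to the sphere at its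
  points.\<close>

definition max_ratio :: "real \<Rightarrow> real" where "max_ratio R = scal R * R\<^sup>2 * twist (R\<^sup>2)"

abbreviation zhat :: "real^3" where "zhat \<equiv> vector [0, 0, 1]"

definition cal_pot :: "real \<Rightarrow> real^3 \<Rightarrow> real" where
  "cal_pot R x = scal R * x $ 3 * (pot 0 (R\<^sup>2) - pot 0 ((norm x)\<^sup>2))"

text \<open>The second vector is orthogonal to \<open>x\<close>, so the radial component is that of
  the constant field alone.\<close>

definition cal_field :: "real \<Rightarrow> field3" where
  "cal_field R x = max_ratio R *\<^sub>R zhat + (scal R * twist ((norm x)\<^sup>2)) *\<^sub>R (x $ 3 *\<^sub>R x - (norm x)\<^sup>2 *\<^sub>R zhat)"

lemma smooth_closure_pot: "smooth_closure (\<lambda>x. pot n ((norm x)\<^sup>2))"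
  by (rule smooth_closure.compose[where U = pot and f = "\<lambda>x. (norm x)\<^sup>2"])
    (auto intro: smooth_closure_norm_square pot_has_derivative)

lemma smooth_closure_cal_pot: "smooth_closure (cal_pot R)"
  unfolding cal_pot_def[abs_def]
  by (intro smooth_closure.mult smooth_closure_diff smooth_closure.const smooth_closure_coord smooth_closure_pot)

lemma cal_pot_sphere: "x \<in> sphere 0 R \<Longrightarrow> cal_pot R x = 0"
  by (simp add: cal_pot_def)

lemma grad_cal_pot:
  "grad3 (cal_pot R) x = (scal R * (pot 0 (R\<^sup>2) - pot 0 ((norm x)\<^sup>2))) *\<^sub>R zhat
     - (2 * scal R * x $ 3 * pot 1 ((norm x)\<^sup>2)) *\<^sub>R x"
proof (rule grad3_eqI)
  have zh: "zhat \<bullet> h = h $ 3" for h by (simp add: inner_vec_def sum_3)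
  have d1: "((\<lambda>x. (norm x)\<^sup>2) has_derivative (\<lambda>h. 2 * (x \<bullet> h))) (at x)" for x :: "real^3"
    unfolding power2_norm_eq_inner
    by (rule derivative_eq_intros refl | simp add: inner_commute)+
  have d2: "(pot 0 has_derivative (\<lambda>h. pot 1 t * h)) (at t)" for t
    using pot_has_derivative[of 0 t] by (simp add: has_field_derivative_def)
  have d3: "((\<lambda>x. pot 0 ((norm x)\<^sup>2)) has_derivative (\<lambda>h. pot 1 ((norm x)\<^sup>2) * (2 * (x \<bullet> h)))) (at x)"
    by (rule has_derivative_compose[OF d1 d2])
  have d4: "((\<lambda>x::real^3. x $ 3) has_derivative (\<lambda>h. h $ 3)) (at x)"
    by (rule bounded_linear.has_derivative[OF bounded_linear_vec_nth has_derivative_ident])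
  have "(cal_pot R has_derivative (\<lambda>h. scal R * x $ 3 * (0 - pot 1 ((norm x)\<^sup>2) * (2 * (x \<bullet> h)))
      + scal R * h $ 3 * (pot 0 (R\<^sup>2) - pot 0 ((norm x)\<^sup>2)))) (at x)"
    unfolding cal_pot_def[abs_def]
    by (intro has_derivative_mult has_derivative_diff has_derivative_const has_derivative_mult_right d3 d4)
  then show "(cal_pot R has_derivative (\<lambda>h. ((scal R * (pot 0 (R\<^sup>2) - pot 0 ((norm x)\<^sup>2))) *\<^sub>R zhat
     - (2 * scal R * x $ 3 * pot 1 ((norm x)\<^sup>2)) *\<^sub>R x) \<bullet> h)) (at x)"
    by (rule has_derivative_eq_rhs) (simp add: fun_eq_iff inner_diff_left zh algebra_simps)
qed

text \<open>Both sides are reduced to combinations of \<open>zhat\<close> and \<open>x\<close>. The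
  coefficients agree by the two series identities together with h(s) = A(s) + s
  \<open>twist s\<close>, where h is the polar-angle profile.\<close>

lemma B0_decomposition:
  assumes R: "R > 0"
  shows "B0 R x = cal_field R x + grad3 (cal_pot R) x"
proof -
  define h where "h s = pot 0 s + 5 * s * pot 1 s + 2 * s\<^sup>2 * pot 2 s" for s
  have C: "C_R R = scal R * h (R\<^sup>2)"
    unfolding C_R_def scal_def sinh_minus_cosh_eq_pot[OF R] h_def[symmetric]
    using R by (simp add: field_simps power2_eq_square)
  have tw: "s * twist s = h s - pot 0 s" for s
    by (simp add: twist_def h_def algebra_simps power2_eq_square)
  have mr: "max_ratio R = scal R * (h (R\<^sup>2) - pot 0 (R\<^sup>2))"
    using tw[of "R\<^sup>2"] by (simp add: max_ratio_def mult.assoc)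
  define s where "s = (norm x)\<^sup>2"
  have rhs: "cal_field R x + grad3 (cal_pot R) x =
    (C_R R - scal R * h s) *\<^sub>R zhat + (scal R * (twist s - 2 * pot 1 s) * x $ 3) *\<^sub>R x"
  proof -
    have "scal R * twist s * s = scal R * (h s - pot 0 s)" using tw[of s] by (simp add: mult_ac)
    then show ?thesis
      unfolding cal_field_def grad_cal_pot C mr s_def[symmetric]
      by (simp add: vec_eq_iff forall_3 algebra_simps)
  qed
  show ?thesis
  proof (cases "x = 0")
    case True
    \<comment> \<open>The removable value prescribed at the origin: \<open>scal R / 3\<close> is
      \<open>R / sinh R\<close>.\<close>
    have "pot 0 0 = 1 / 3" by (simp add: pot_0 pot_coeff_def eval_nat_numeral)
    then have "scal R * h 0 = R / sinh R" by (simp add: h_def scal_def)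
    then show ?thesis unfolding rhs using True by (simp add: B0_def s_def)
  next
    case False
    define r where "r = norm x"
    have r: "r > 0" using False by (simp add: r_def)
    have sr: "s = r\<^sup>2" by (simp add: s_def r_def)
    have g: "3 * R / (r\<^sup>2 * sinh R) * (cosh r - sinh r / r) = scal R * (pot 0 s + 2 * s * pot 1 s)"
      unfolding cosh_minus_sinh_div_eq_pot[OF r] sr using r by (simp add: scal_def)
    have hh: "3 * R / (2 * r\<^sup>2 * sinh R) * ((1 + r\<^sup>2) / r * sinh r - cosh r) = scal R * h s"
      unfolding sinh_minus_cosh_eq_pot[OF r] sr h_def using r by (simp add: scal_def)
    have vec: "(vector [x $ 1 * x $ 3, x $ 2 * x $ 3, - ((x $ 1)\<^sup>2 + (x $ 2)\<^sup>2)] :: real^3) = x $ 3 *\<^sub>R x - s *\<^sub>R zhat"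
    proof -
      have "s = (x $ 1)\<^sup>2 + (x $ 2)\<^sup>2 + (x $ 3)\<^sup>2"
        by (simp add: s_def norm_square_3)
      then show ?thesis by (simp add: vec_eq_iff forall_3 power2_eq_square)
    qed
    have "B0 R x = C_R R *\<^sub>R zhat - (scal R * (pot 0 s + 2 * s * pot 1 s) * (x $ 3 / r)) *\<^sub>R ((1 / r) *\<^sub>R x)
        + (scal R * h s) *\<^sub>R ((1 / r\<^sup>2) *\<^sub>R (x $ 3 *\<^sub>R x - s *\<^sub>R zhat))"
      using False unfolding B0_def Let_def r_def[symmetric] g hh vec by simp
    also have "\<dots> = C_R R *\<^sub>R zhat - (scal R * (pot 0 s + 2 * s * pot 1 s) * x $ 3 / s) *\<^sub>R x
        + (scal R * h s / s) *\<^sub>R (x $ 3 *\<^sub>R x - s *\<^sub>R zhat)"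
      by (simp add: sr power2_eq_square)
    also have "\<dots> = (C_R R - scal R * h s) *\<^sub>R zhat + (scal R * (twist s - 2 * pot 1 s) * x $ 3) *\<^sub>R x"
    proof -
      have "h s = pot 0 s + s * twist s" using tw[of s] by simp
      moreover have "s > 0" using r by (simp add: sr)
      ultimately show ?thesis by (simp add: vec_eq_iff forall_3 field_simps)
    qed
    finally show ?thesis unfolding rhs .
  qed
qed

section \<open>Pointwise bounds for the calibrating field\<close>

definition axis_dist :: "real^3 \<Rightarrow> real" where
  "axis_dist x = sqrt ((x $ 1)\<^sup>2 + (x $ 2)\<^sup>2)"

lemma axis_dist_nonneg: "axis_dist x \<ge> 0"
  by (simp add: axis_dist_def)

lemma axis_dist_square: "(axis_dist x)\<^sup>2 = (x $ 1)\<^sup>2 + (x $ 2)\<^sup>2"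
  by (simp add: axis_dist_def)

lemma axis_dist_le_norm: "axis_dist x \<le> norm x"
  by (rule power2_le_imp_le) (simp_all add: axis_dist_square norm_square_3)

lemma inner_zhat: "x \<bullet> zhat = x $ 3"
  by (simp add: inner_vec_def sum_3)

lemma norm_zhat [simp]: "norm zhat = 1"
proof -
  have "(norm zhat)\<^sup>2 = 1\<^sup>2" by (simp add: norm_square_3)
  then show ?thesis by (simp only: power2_eq_iff_nonneg norm_ge_zero zero_le_one)
qed

lemma zhat_nonzero [simp]: "zhat \<noteq> 0"
  by (metis norm_zero norm_zhat zero_neq_one)

lemma twist_mono: "0 \<le> s \<Longrightarrow> s \<le> t \<Longrightarrow> twist s \<le> twist t"
  unfolding twist_def using pot_mono[of s t 1] pot_mono[of s t 2] pot_pos[of s 1] pot_pos[of s 2]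
  by (intro add_mono mult_mono) auto

lemma twist_pos: "0 \<le> s \<Longrightarrow> twist s > 0"
  unfolding twist_def using pot_pos[of s 1] pot_pos[of s 2] by (intro add_pos_nonneg) auto

lemma scal_pos: "R > 0 \<Longrightarrow> scal R > 0"
  by (simp add: scal_def)

lemma max_ratio_pos: "R > 0 \<Longrightarrow> max_ratio R > 0"
  by (simp add: max_ratio_def scal_pos twist_pos)

lemma continuous_on_cal_field: "continuous_on S (cal_field R)"
  unfolding cal_field_def[abs_def] twist_def
  by (intro continuous_intros smooth_closure_continuous_on[OF smooth_closure_pot])

text \<open>All follow from monotonicity of \<open>twist\<close>. The last bound, an equality on the
  sphere, keeps the factor \<open>2 * max_ratio R - p * (norm x)\<^sup>2\<close> of the norm
  identity above \<open>max_ratio R\<close>.\<close>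

lemma cal_field_twist_bounds:
  assumes R: "R > 0" and x: "x \<in> cball 0 R"
  defines "p \<equiv> scal R * twist ((norm x)\<^sup>2)"
  shows "p > 0" "p \<ge> scal R * twist 0" "p \<le> max_ratio R / R\<^sup>2" "p * (norm x)\<^sup>2 \<le> max_ratio R"
proof -
  have s: "(norm x)\<^sup>2 \<le> R\<^sup>2" using x by (intro power_mono) auto
  show "p > 0" using R by (simp add: p_def scal_pos twist_pos)
  show "p \<ge> scal R * twist 0" unfolding p_def
    using scal_pos[OF R] by (intro mult_left_mono twist_mono) auto
  have le: "p \<le> scal R * twist (R\<^sup>2)" unfolding p_def
    using scal_pos[OF R] s by (intro mult_left_mono twist_mono) auto
  then show "p \<le> max_ratio R / R\<^sup>2" using R by (simp add: max_ratio_def)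
  have "p * (norm x)\<^sup>2 \<le> (scal R * twist (R\<^sup>2)) * R\<^sup>2"
    using le s scal_pos[OF R] twist_pos[of "R\<^sup>2"] by (intro mult_mono) auto
  then show "p * (norm x)\<^sup>2 \<le> max_ratio R" by (simp add: max_ratio_def mult_ac)
qed

text \<open>With \<rho> the distance to the axis, the tangential vector in \<open>cal_field\<close>
  has vertical component -\<rho>^2 and squared length |x|^2 \<rho>^2; expanding the square gives the
  formula.\<close>

lemma norm_cal_field_square:
  fixes R :: real and x :: "real^3"
  defines "p \<equiv> scal R * twist ((norm x)\<^sup>2)"
  shows "(norm (cal_field R x))\<^sup>2 =
    (max_ratio R)\<^sup>2 - p * (axis_dist x)\<^sup>2 * (2 * max_ratio R - p * (norm x)\<^sup>2)"
proof -
  have "(norm (cal_field R x))\<^sup>2 = (p * (x $ 3 * x $ 1))\<^sup>2 + (p * (x $ 3 * x $ 2))\<^sup>2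
      + (max_ratio R + p * (x $ 3 * x $ 3 - (norm x)\<^sup>2))\<^sup>2"
    unfolding norm_square_3[of "cal_field R x"] by (simp add: cal_field_def p_def)
  moreover have "(p * (a3 * a1))\<^sup>2 + (p * (a3 * a2))\<^sup>2
      + (l + p * (a3 * a3 - (a1\<^sup>2 + a2\<^sup>2 + a3\<^sup>2)))\<^sup>2
      = l\<^sup>2 - p * (a1\<^sup>2 + a2\<^sup>2) * (2 * l - p * (a1\<^sup>2 + a2\<^sup>2 + a3\<^sup>2))" for a1 a2 a3 l
    by (simp add: power2_eq_square algebra_simps)
  ultimately show ?thesis by (simp only: axis_dist_square norm_square_3[of x])
qed

text \<open>Quadratic decay away from the axis; this is the source of the exponent 2.\<close>
lemma norm_cal_field_square_le:
  assumes R: "R > 0" and x: "x \<in> cball 0 R"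
  shows "(norm (cal_field R x))\<^sup>2 \<le> (max_ratio R)\<^sup>2 - max_ratio R * scal R * twist 0 * (axis_dist x)\<^sup>2"
proof -
  define p where "p = scal R * twist ((norm x)\<^sup>2)"
  note b = cal_field_twist_bounds[OF R x, folded p_def]
  have "scal R * twist 0 * (axis_dist x)\<^sup>2 * max_ratio R
      \<le> p * (axis_dist x)\<^sup>2 * (2 * max_ratio R - p * (norm x)\<^sup>2)"
    using b max_ratio_pos[OF R] by (intro mult_mono) auto
  then show ?thesis unfolding norm_cal_field_square p_def[symmetric] by (simp add: mult_ac)
qed

lemma norm_cal_field_le:
  assumes R: "R > 0" and x: "x \<in> cball 0 R"
  shows "norm (cal_field R x) \<le> max_ratio R"
proof (rule power2_le_imp_le)
  have "0 \<le> max_ratio R * scal R * twist 0 * (axis_dist x)\<^sup>2"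
    using max_ratio_pos[OF R] scal_pos[OF R] twist_pos[of 0] by simp
  then show "(norm (cal_field R x))\<^sup>2 \<le> (max_ratio R)\<^sup>2"
    using norm_cal_field_square_le[OF R x] by linarith
qed (use max_ratio_pos[OF R] in simp)

text \<open>The deviation has length p |x| \<rho>, and p |x| is at most \<lambda>/R on the ball.
  This first-order bound controls the cross term when the calibration is perturbed.\<close>

lemma norm_cal_field_minus_le:
  assumes R: "R > 0" and x: "x \<in> cball 0 R"
  shows "norm (cal_field R x - max_ratio R *\<^sub>R zhat) \<le> max_ratio R / R * axis_dist x"
proof (rule power2_le_imp_le)
  define p where "p = scal R * twist ((norm x)\<^sup>2)"
  note b = cal_field_twist_bounds[OF R x, folded p_def]
  have "(norm (cal_field R x - max_ratio R *\<^sub>R zhat))\<^sup>2 =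
      (p * (x $ 3 * x $ 1))\<^sup>2 + (p * (x $ 3 * x $ 2))\<^sup>2 + (p * (x $ 3 * x $ 3 - (norm x)\<^sup>2))\<^sup>2"
    unfolding norm_square_3[of "cal_field R x - _"] by (simp add: cal_field_def p_def)
  also have "\<dots> = p\<^sup>2 * (axis_dist x)\<^sup>2 * (norm x)\<^sup>2"
    unfolding axis_dist_square norm_square_3[of x] by (simp add: power2_eq_square algebra_simps)
  also have "\<dots> \<le> (max_ratio R / R\<^sup>2)\<^sup>2 * (axis_dist x)\<^sup>2 * R\<^sup>2"
    using b x R axis_dist_nonneg by (intro mult_mono power_mono) auto
  also have "\<dots> = (max_ratio R / R * axis_dist x)\<^sup>2"
    using R by (simp add: field_simps power2_eq_square)
  finally show "(norm (cal_field R x - max_ratio R *\<^sub>R zhat))\<^sup>2 \<le> (max_ratio R / R * axis_dist x)\<^sup>2" .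
qed (use R max_ratio_pos[OF R] axis_dist_nonneg in simp)

section \<open>The maximal ratio and nearly optimal currents\<close>

lemma continuous_on_B0: "R > 0 \<Longrightarrow> continuous_on S (B0 R)"
  by (simp add: B0_decomposition[THEN ext] continuous_on_add continuous_on_cal_field
      smooth_closure_continuous_grad3 smooth_closure_cal_pot)

lemma normal_current_B0:
  assumes R: "R > 0" and T: "T \<in> normal_currents R"
  shows "T (B0 R) = T (cal_field R)"
proof -
  have fin: "finite_mass_current R T" using T by (simp add: normal_currents_def)
  have "T (B0 R) = T (\<lambda>x. cal_field R x + grad3 (cal_pot R) x)"
    by (rule current_cong[OF fin continuous_on_B0[OF R] B0_decomposition[OF R]])
  also have "\<dots> = T (cal_field R) + T (grad3 (cal_pot R))"
    by (rule current_add[OF fin continuous_on_cal_field smooth_closure_continuous_grad3[OF smooth_closure_cal_pot]])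
  also have "T (grad3 (cal_pot R)) = 0"
    by (rule normal_current_gradient_eq_0[OF T R smooth_closure_cal_pot cal_pot_sphere])
  finally show ?thesis by simp
qed

lemma ratio_le_max_ratio:
  assumes R: "R > 0" and T: "T \<in> normal_currents R"
  shows "ratio R T \<le> max_ratio R"
proof -
  have fin: "finite_mass_current R T" using T by (simp add: normal_currents_def)
  have "T (B0 R) \<le> max_ratio R * mass T"
    unfolding normal_current_B0[OF R T]
    by (rule current_le_mass_scaled[OF fin R continuous_on_cal_field max_ratio_pos[OF R] norm_cal_field_le[OF R]])
  \<comment> \<open>For zero mass the quotient is 0 by the convention on division, below the
    positive maximum.\<close>
  then show ?thesis
    using mass_nonneg[OF fin] max_ratio_pos[OF R]
    by (cases "mass T = 0") (auto simp: ratio_def divide_le_eq)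
qed

text \<open>A current that almost attains the maximum gives little value to fields that do not reward
  moving along the axis: perturb the calibrating field \<open>cal_field R\<close> by a small multiple of \<open>V\<close>
  and compare with the mass.\<close>
lemma near_optimal_current_small:
  assumes R: "R > 0"
  obtains N where "N > 0"
    "\<And>T V K \<delta>. T \<in> normal_currents R \<Longrightarrow> K > 0 \<Longrightarrow> \<delta> > 0 \<Longrightarrow> continuous_on (cball 0 R) V \<Longrightarrow>
      (\<And>x. x \<in> cball 0 R \<Longrightarrow> norm (V x) \<le> K) \<Longrightarrow>
      (\<And>x. x \<in> cball 0 R \<Longrightarrow> V x $ 3 \<le> K * axis_dist x) \<Longrightarrow>
      (max_ratio R - \<delta>\<^sup>2) * mass T \<le> T (B0 R) \<Longrightarrow> T V \<le> K * N * mass T * \<delta>"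
proof -
  define l where "l = max_ratio R"
  \<comment> \<open>\<open>a\<close> is the rate of quadratic decay of |\<omega>|^2,
    \<open>K * e\<close> the rate at which the pairing of \<omega> with \<open>V\<close> may grow in
    \<rho>, and \<open>b\<close> the cost of absorbing the second into the first by completing the
    square.\<close>
  define a where "a = l * scal R * twist 0"
  define e where "e = l * (1 + 1 / R)"
  define b where "b = e\<^sup>2 / a + 1"
  have l0: "l > 0" unfolding l_def by (rule max_ratio_pos[OF R])
  have a0: "a > 0" unfolding a_def using l0 scal_pos[OF R] twist_pos[of 0] by simp
  have b0: "b > 0" unfolding b_def using a0 by (intro add_nonneg_pos) auto
  have "T V \<le> K * (1 + b / (2 * l)) * mass T * \<delta>"
    if T: "T \<in> normal_currents R" and K: "K > 0" and \<delta>: "\<delta> > 0" and V: "continuous_on (cball 0 R) V"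
      and VK: "\<And>x. x \<in> cball 0 R \<Longrightarrow> norm (V x) \<le> K"
      and V3: "\<And>x. x \<in> cball 0 R \<Longrightarrow> V x $ 3 \<le> K * axis_dist x"
      and opt: "(max_ratio R - \<delta>\<^sup>2) * mass T \<le> T (B0 R)" for T V K \<delta>
  proof -
    have fin: "finite_mass_current R T" using T by (simp add: normal_currents_def)
    \<comment> \<open>This size turns \<epsilon>^2 K^2 into \<delta>^2, the order of the deficit;
      cancelling one factor \<delta> at the end leaves a bound linear in \<delta>.\<close>
    define \<epsilon> where "\<epsilon> = \<delta> / K"
    have \<epsilon>: "\<epsilon> > 0" "\<epsilon> * K = \<delta>" using K \<delta> by (auto simp: \<epsilon>_def)
    have bound: "norm (cal_field R x + \<epsilon> *\<^sub>R V x) \<le> l + \<delta>\<^sup>2 * b / (2 * l)" if x: "x \<in> cball 0 R" for x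
    proof (rule power2_le_imp_le)
      define \<rho> where "\<rho> = axis_dist x"
      have \<rho>0: "\<rho> \<ge> 0" by (simp add: \<rho>_def axis_dist_nonneg)
      have "cal_field R x \<bullet> V x = l * V x $ 3 + (cal_field R x - l *\<^sub>R zhat) \<bullet> V x"
        using inner_zhat[of "V x"] by (simp add: inner_diff_left inner_commute[of zhat])
      also have "\<dots> \<le> l * (K * \<rho>) + (l / R * \<rho>) * K"
      proof (rule add_mono)
        show "l * V x $ 3 \<le> l * (K * \<rho>)" using V3[OF x] l0 by (simp add: \<rho>_def)
        have "(cal_field R x - l *\<^sub>R zhat) \<bullet> V x \<le> norm (cal_field R x - l *\<^sub>R zhat) * norm (V x)"
          by (rule norm_cauchy_schwarz)
        also have "\<dots> \<le> (l / R * \<rho>) * K"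
          using norm_cal_field_minus_le[OF R x] VK[OF x] l0 R \<rho>0
          by (intro mult_mono) (auto simp: \<rho>_def l_def)
        finally show "(cal_field R x - l *\<^sub>R zhat) \<bullet> V x \<le> (l / R * \<rho>) * K" .
      qed
      also have "\<dots> = K * e * \<rho>" by (simp add: e_def algebra_simps)
      finally have iv: "cal_field R x \<bullet> V x \<le> K * e * \<rho>" .
      have "(norm (cal_field R x + \<epsilon> *\<^sub>R V x))\<^sup>2
          = (norm (cal_field R x))\<^sup>2 + 2 * \<epsilon> * (cal_field R x \<bullet> V x) + \<epsilon>\<^sup>2 * (norm (V x))\<^sup>2"
        unfolding power2_norm_eq_inner
        by (simp add: inner_add_left inner_add_right inner_commute power2_eq_square algebra_simps)
      also have "\<dots> \<le> (l\<^sup>2 - a * \<rho>\<^sup>2) + 2 * \<epsilon> * (K * e * \<rho>) + \<epsilon>\<^sup>2 * K\<^sup>2"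
        using norm_cal_field_square_le[OF R x] iv VK[OF x] \<epsilon>(1)
        by (intro add_mono mult_left_mono power_mono) (auto simp: l_def a_def \<rho>_def)
      also have "\<dots> = l\<^sup>2 - a * \<rho>\<^sup>2 + 2 * \<delta> * e * \<rho> + \<delta>\<^sup>2"
        by (simp flip: \<epsilon>(2) add: power_mult_distrib algebra_simps)
      also have "\<dots> \<le> l\<^sup>2 + \<delta>\<^sup>2 * b"
      proof -
        have "0 \<le> (a * \<rho> - \<delta> * e)\<^sup>2 / a" using a0 by simp
        also have "\<dots> = a * \<rho>\<^sup>2 - 2 * \<delta> * e * \<rho> + \<delta>\<^sup>2 * (e\<^sup>2 / a)"
          using a0 by (simp add: power2_eq_square field_simps)
        finally show ?thesis by (simp add: b_def algebra_simps)
      qed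
      also have "\<dots> \<le> (l + \<delta>\<^sup>2 * b / (2 * l))\<^sup>2"
        using l0 by (simp add: power2_sum)
      finally show "(norm (cal_field R x + \<epsilon> *\<^sub>R V x))\<^sup>2 \<le> (l + \<delta>\<^sup>2 * b / (2 * l))\<^sup>2" .
    qed (use l0 b0 in simp)
    have cont: "continuous_on (cball 0 R) (\<lambda>x. cal_field R x + \<epsilon> *\<^sub>R V x)"
      by (intro continuous_intros V continuous_on_cal_field)
    have "T (cal_field R) + \<epsilon> * T V = T (\<lambda>x. cal_field R x + \<epsilon> *\<^sub>R V x)"
      using V by (simp add: current_add[OF fin] current_scale[OF fin] continuous_on_cal_field
          continuous_on_scaleR continuous_on_const)
    also have "\<dots> \<le> (l + \<delta>\<^sup>2 * b / (2 * l)) * mass T"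
      using l0 b0 by (intro current_le_mass_scaled[OF fin R cont _ bound] add_pos_nonneg) auto
    finally have "\<epsilon> * T V \<le> (l + \<delta>\<^sup>2 * b / (2 * l)) * mass T - (l - \<delta>\<^sup>2) * mass T"
      using opt normal_current_B0[OF R T] by (simp add: l_def)
    also have "\<dots> = \<delta> * ((1 + b / (2 * l)) * mass T * \<delta>)"
      by (simp add: algebra_simps power2_eq_square)
    finally have "K * (\<epsilon> * T V) \<le> K * (\<delta> * ((1 + b / (2 * l)) * mass T * \<delta>))"
      using K by (intro mult_left_mono) auto
    moreover have "K * (\<epsilon> * T V) = \<delta> * T V" using \<epsilon>(2) by (simp add: mult_ac)
    ultimately have "\<delta> * T V \<le> \<delta> * (K * (1 + b / (2 * l)) * mass T * \<delta>)"
      by (simp only: mult_ac)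
    then show ?thesis using \<delta> by (simp only: mult_le_cancel_left_pos)
  qed
  then show thesis using that[of "1 + b / (2 * l)"] l0 b0 by (simp add: add_pos_pos)
qed

section \<open>The vertical diameter\<close>

lemma scaleR_zhat: "z *\<^sub>R zhat = vector [0, 0, z]"
  by (simp add: vec_eq_iff forall_3)

lemma continuous_on_vertical: "continuous_on S (\<lambda>z. vector [0, 0, z] :: real^3)"
  using continuous_on_scaleR[OF continuous_on_id continuous_on_const, of S zhat] by (simp add: scaleR_zhat)

definition vertical_diameter :: "real \<Rightarrow> real \<Rightarrow> real^3" where
  "vertical_diameter R t = (- R + 2 * R * t) *\<^sub>R zhat"

lemma vertical_diameter_has_vector_derivative:
  "(vertical_diameter R has_vector_derivative (2 * R) *\<^sub>R zhat) (at t within S)"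
  unfolding vertical_diameter_def[abs_def]
  by (rule derivative_eq_intros refl | simp)+

lemma vertical_diameter_lipschitz:
  assumes "R > 0" shows "(2 * R)-lipschitz_on S (vertical_diameter R)"
proof (rule lipschitz_onI)
  fix s t
  have "vertical_diameter R s - vertical_diameter R t = (2 * R * (s - t)) *\<^sub>R zhat"
    unfolding vertical_diameter_def scaleR_left_diff_distrib[symmetric] by (simp add: algebra_simps)
  then show "dist (vertical_diameter R s) (vertical_diameter R t) \<le> 2 * R * dist s t"
    using assms by (simp add: dist_norm abs_mult)
qed (use assms in simp)

lemma vertical_diameter_in_cball:
  assumes "R > 0" shows "vertical_diameter R ` {0..1} \<subseteq> cball 0 R"
proof clarify
  fix t :: real assume t: "t \<in> {0..1}"
  have "R * t \<le> R * 1" using t assms by (intro mult_left_mono) auto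
  moreover have "R * t \<ge> 0" using t assms by simp
  ultimately have "\<bar>- R + 2 * R * t\<bar> \<le> R" by (simp add: abs_le_iff)
  then show "vertical_diameter R t \<in> cball 0 R" by (simp add: vertical_diameter_def)
qed

lemma Gamma0_eq_curve_current:
  assumes R: "R > 0"
  shows "Gamma0 R B = curve_current (vertical_diameter R) B"
proof -
  have "Gamma0 R B = (\<integral>z. indicator {-R..R} z * B (z *\<^sub>R zhat) $ 3 \<partial>lborel)"
    by (simp add: Gamma0_def set_lebesgue_integral_def scaleR_zhat)
  also have "\<dots> = \<bar>2 * R\<bar> *\<^sub>R (\<integral>t. indicator {-R..R} (-R + 2 * R * t) * B ((-R + 2 * R * t) *\<^sub>R zhat) $ 3 \<partial>lborel)"
    using R by (intro lborel_integral_real_affine) auto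
  also have "\<dots> = (\<integral>t. 2 * R * (indicator {-R..R} (-R + 2 * R * t) * B ((-R + 2 * R * t) *\<^sub>R zhat) $ 3) \<partial>lborel)"
    using R by simp
  also have "\<dots> = (\<integral>t. indicator {0..1} t *\<^sub>R (B (vertical_diameter R t) \<bullet> vector_derivative (vertical_diameter R) (at t within {0..1})) \<partial>lborel)"
  proof (rule Bochner_Integration.integral_cong[OF refl])
    fix t :: real
    have "-R + 2 * R * t \<in> {-R..R} \<longleftrightarrow> t \<in> {0..1}"
      using R by (auto simp: zero_le_mult_iff)
    moreover have "vector_derivative (vertical_diameter R) (at t within {0..1}) = (2 * R) *\<^sub>R zhat" if "t \<in> {0..1}"
      using vector_derivative_within_cbox[of 0 1 t "vertical_diameter R"] that vertical_diameter_has_vector_derivative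
      by simp
    ultimately show "2 * R * (indicator {-R..R} (-R + 2 * R * t) * B ((-R + 2 * R * t) *\<^sub>R zhat) $ 3) =
      indicator {0..1} t *\<^sub>R (B (vertical_diameter R t) \<bullet> vector_derivative (vertical_diameter R) (at t within {0..1}))"
      by (auto simp: indicator_def vertical_diameter_def inner_zhat)
  qed
  also have "\<dots> = curve_current (vertical_diameter R) B"
    by (simp add: curve_current_def set_lebesgue_integral_def)
  finally show ?thesis .
qed

lemma finite_mass_current_Gamma0:
  assumes R: "R > 0"
  shows "finite_mass_current R (Gamma0 R)"
proof -
  define I where "I = restrict_space lborel {-R..R}"
  define \<phi> where "\<phi> z = z *\<^sub>R zhat" for z
  define \<mu> where "\<mu> = distr I (restrict_space borel (cball 0 R)) \<phi>"
  have \<phi>: "\<phi> \<in> measurable I (restrict_space borel (cball 0 R))"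
  proof (rule measurable_restrict_space2)
    show "\<phi> \<in> space I \<rightarrow> cball 0 R"
      using R by (auto simp: I_def space_restrict_space \<phi>_def)
    show "\<phi> \<in> borel_measurable I"
      unfolding I_def \<phi>_def by (intro measurable_restrict_space1) simp
  qed
  interpret I: finite_measure I
    using R by (auto simp: I_def emeasure_restrict_space intro!: finite_measureI)
  have "Gamma0 R B = (\<integral>x. B x \<bullet> zhat \<partial>\<mu>)" if B: "continuous_on (cball 0 R) B" for B
  proof -
    have "(\<lambda>x. B x \<bullet> zhat) \<in> borel_measurable (restrict_space borel (cball 0 R))"
      using B by (intro borel_measurable_continuous_on_restrict continuous_intros)
    then have "(\<integral>x. B x \<bullet> zhat \<partial>\<mu>) = (\<integral>z. B (\<phi> z) \<bullet> zhat \<partial>I)"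
      unfolding \<mu>_def by (rule integral_distr[OF \<phi>])
    also have "\<dots> = (\<integral>z. indicator {-R..R} z *\<^sub>R (B (\<phi> z) \<bullet> zhat) \<partial>lborel)"
      unfolding I_def by (rule integral_restrict_space) simp
    also have "\<dots> = Gamma0 R B"
      by (simp add: Gamma0_def set_lebesgue_integral_def scaleR_zhat inner_zhat \<phi>_def)
    finally show ?thesis by simp
  qed
  moreover have "finite_measure \<mu>" unfolding \<mu>_def by (rule I.finite_measure_distr[OF \<phi>])
  ultimately show ?thesis
    unfolding finite_mass_current_def
    by (intro exI[of _ \<mu>] exI[of _ "\<lambda>_. zhat"]) (auto simp: \<mu>_def)
qed

lemma smooth3_D:
  assumes "smooth3 f"
  shows "f differentiable (at x)" "continuous_on S (grad3 f)"
proof -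
  have *: "\<forall>x. f differentiable (at x)" "\<forall>i. smooth3 (\<lambda>x. frechet_derivative f (at x) (axis i 1))"
    using assms by (auto elim: smooth3.cases)
  show "f differentiable (at x)" using * by blast
  show "continuous_on S (grad3 f)"
    unfolding grad3_def using * by (auto intro!: continuous_on_vec_lambda smooth3_continuous_on)
qed

lemma Gamma0_gradient:
  assumes R: "R > 0" and f: "smooth3 f"
  shows "Gamma0 R (grad3 f) = f (R *\<^sub>R zhat) - f (- R *\<^sub>R zhat)"
proof -
  have "curve_current (vertical_diameter R) (grad3 f) = f (vertical_diameter R 1) - f (vertical_diameter R 0)"
    using vertical_diameter_lipschitz[OF R] compact_cball convex_cball vertical_diameter_in_cball[OF R]
  proof (rule curve_current_gradient)
    show "(f has_derivative (\<lambda>h. grad3 f x \<bullet> h)) (at x within cball 0 R)" for x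
      using has_derivative_grad3[OF smooth3_D(1)[OF f]] by (rule has_derivative_at_withinI)
  qed (rule smooth3_D(2)[OF f])
  then show ?thesis by (simp add: Gamma0_eq_curve_current[OF R] vertical_diameter_def)
qed

lemma Gamma0_normal:
  assumes R: "R > 0"
  shows "Gamma0 R \<in> normal_currents R"
  unfolding normal_currents_def
\<comment> \<open>The boundary consists of opposite unit point masses at the poles, hence the bound
  2.\<close>
proof (intro CollectI conjI exI[of _ 2] allI impI)
  show "finite_mass_current R (Gamma0 R)" by (rule finite_mass_current_Gamma0[OF R])
  fix f
  show "Gamma0 R (grad3 f) \<le> 2" if "test_fn f \<and> (\<forall>x. \<bar>f x\<bar> \<le> 1)"
  proof -
    have "\<bar>f (R *\<^sub>R zhat)\<bar> \<le> 1" "\<bar>f (- R *\<^sub>R zhat)\<bar> \<le> 1" using that by blast+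
    moreover have "Gamma0 R (grad3 f) = f (R *\<^sub>R zhat) - f (- R *\<^sub>R zhat)"
      using that by (intro Gamma0_gradient[OF R]) (simp add: test_fn_def)
    ultimately show ?thesis by linarith
  qed
  show "Gamma0 R (grad3 f) = 0" if f: "test_fn f \<and> closure {x. f x \<noteq> 0} \<inter> sphere 0 R = {}"
  proof -
    have "f x = 0" if "x \<in> sphere 0 R" for x
      using f that closure_subset[of "{x. f x \<noteq> 0}"] by auto
    moreover have "R *\<^sub>R zhat \<in> sphere 0 R" "- R *\<^sub>R zhat \<in> sphere 0 R" using R by auto
    ultimately show ?thesis using f by (simp add: Gamma0_gradient[OF R] test_fn_def)
  qed
qed

lemma Gamma0_in_curves_X:
  assumes R: "R > 0"
  shows "Gamma0 R \<in> curves_X R"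
proof -
  have "simple_lip_curve R (vertical_diameter R)"
    unfolding simple_lip_curve_def
  proof (intro conjI disjI2)
    show "\<exists>L. L-lipschitz_on {0..1} (vertical_diameter R)" using vertical_diameter_lipschitz[OF R] by blast
    show "vertical_diameter R ` {0..1} \<subseteq> cball 0 R" by (rule vertical_diameter_in_cball[OF R])
    show "inj_on (vertical_diameter R) {0..1}" using R by (auto simp: inj_on_def vertical_diameter_def)
  qed (use R in \<open>auto simp: vertical_diameter_def\<close>)
  then show ?thesis
    using Gamma0_normal[OF R] Gamma0_eq_curve_current[OF R] by (auto simp: curves_X_def)
qed

lemma Gamma0_const: "R > 0 \<Longrightarrow> Gamma0 R (\<lambda>x. v) = 2 * R * v $ 3"
  by (simp add: Gamma0_def set_lebesgue_integral_def)

lemma mass_Gamma0: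
  assumes R: "R > 0"
  shows "mass (Gamma0 R) = 2 * R"
proof (rule antisym)
  note fin = finite_mass_current_Gamma0[OF R]
  show "2 * R \<le> mass (Gamma0 R)"
    using current_le_mass[OF fin R, of "\<lambda>x. zhat"] Gamma0_const[OF R, of zhat] by simp
  show "mass (Gamma0 R) \<le> 2 * R"
    unfolding mass_def
  proof (rule cSUP_least)
    show "{w. test_form w \<and> (\<forall>x. norm (w x) \<le> 1)} \<noteq> {}" using test_form_zero by fastforce
    fix w assume w: "w \<in> {w. test_form w \<and> (\<forall>x. norm (w x) \<le> 1)}"
    have c: "continuous_on {-R..R} (\<lambda>z. w (vector [0, 0, z]) $ 3)"
      using w
      by (intro continuous_on_component continuous_on_compose2[OF test_form_continuous_on[of w UNIV]] continuous_on_vertical) auto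
    have "Gamma0 R w \<le> (LINT z:{-R..R}|lborel. 1)"
      unfolding Gamma0_def
    proof (rule set_integral_mono)
      show "set_integrable lborel {-R..R} (\<lambda>z. w (vector [0, 0, z]) $ 3)"
        by (rule borel_integrable_atLeastAtMost'[OF c])
      show "set_integrable lborel {-R..R} (\<lambda>z. 1 :: real)"
        by (rule borel_integrable_atLeastAtMost') (rule continuous_on_const)
      fix z
      show "w (vector [0, 0, z]) $ 3 \<le> 1"
        using w component_le_norm_cart[of "w (vector [0, 0, z])" 3] by (simp, metis abs_le_D1 order_trans)
    qed
    then show "Gamma0 R w \<le> 2 * R" using R by (simp add: set_lebesgue_integral_def)
  qed
qed

lemma ratio_Gamma0:
  assumes R: "R > 0"
  shows "ratio R (Gamma0 R) = max_ratio R"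
proof -
  have "cal_field R (vector [0, 0, z]) $ 3 = max_ratio R" for z
  proof -
    have "(norm (vector [0, 0, z] :: real^3))\<^sup>2 = z * z"
      unfolding norm_square_3 by (simp add: power2_eq_square)
    then show ?thesis by (simp add: cal_field_def)
  qed
  then have "Gamma0 R (cal_field R) = 2 * R * max_ratio R"
    using R by (simp add: Gamma0_def set_lebesgue_integral_def)
  then show ?thesis
    using R by (simp add: ratio_def mass_Gamma0 normal_current_B0[OF R Gamma0_normal[OF R]])
qed

text \<open>A point of the sphere close to the axis is close to one of the poles. To exclude the
  same pole for both, equate |p|^2 and |q|^2: the product of q3 - p3 and q3 + p3 is controlled by
  the horizontal shift, of order \<open>c * m\<close>, times \<open>a\<close>. Since q3 - p3 is at
  least \<open>m / 2\<close>, the factor \<open>m\<close> cancels and |q3 + p3| < R, whereas heights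
  of equal sign and size at least R/2 would add up to R or more.\<close>

lemma near_poles:
  fixes p q :: "real^3"
  assumes R: "R > 0" and p: "norm p = R" and q: "norm q = R"
    and pa: "\<bar>p $ 1\<bar> \<le> a" "\<bar>p $ 2\<bar> \<le> a" and qa: "\<bar>q $ 1\<bar> \<le> a" "\<bar>q $ 2\<bar> \<le> a"
    and pq: "\<bar>q $ 1 - p $ 1\<bar> \<le> c * m" "\<bar>q $ 2 - p $ 2\<bar> \<le> c * m"
    and m: "m > 0" and up: "q $ 3 - p $ 3 \<ge> m / 2"
    and small: "2 * a\<^sup>2 \<le> 3 * R\<^sup>2 / 4" "8 * a * c < R"
  shows "R - q $ 3 \<le> 2 * a\<^sup>2 / R" "R + p $ 3 \<le> 2 * a\<^sup>2 / R"
proof -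
  have pole: "\<bar>x $ 3\<bar> \<ge> R / 2 \<and> R - \<bar>x $ 3\<bar> \<le> 2 * a\<^sup>2 / R"
    if x: "norm x = R" "\<bar>x $ 1\<bar> \<le> a" "\<bar>x $ 2\<bar> \<le> a" for x :: "real^3"
  proof -
    have "(x $ 1)\<^sup>2 \<le> a\<^sup>2" "(x $ 2)\<^sup>2 \<le> a\<^sup>2"
      using x(2,3) abs_le_square_iff[of "x $ 1" a] abs_le_square_iff[of "x $ 2" a] by auto
    then have le: "R\<^sup>2 - (x $ 3)\<^sup>2 \<le> 2 * a\<^sup>2" using norm_square_3[of x] x(1) by simp
    have "(R / 2)\<^sup>2 \<le> \<bar>x $ 3\<bar>\<^sup>2" using le small(1) by (simp add: power_divide)
    then have half: "R / 2 \<le> \<bar>x $ 3\<bar>" by (rule power2_le_imp_le) simp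
    have "\<bar>x $ 3\<bar> \<le> R" using component_le_norm_cart[of x 3] x(1) by simp
    then have "(R - \<bar>x $ 3\<bar>) * R \<le> (R - \<bar>x $ 3\<bar>) * (R + \<bar>x $ 3\<bar>)" by (intro mult_left_mono) auto
    also have "\<dots> = R\<^sup>2 - \<bar>x $ 3\<bar>\<^sup>2" by (simp add: algebra_simps power2_eq_square)
    also have "\<dots> \<le> 2 * a\<^sup>2" using le by simp
    finally show ?thesis using half R by (simp add: pos_le_divide_eq)
  qed
  note pp = pole[OF p pa] and qq = pole[OF q qa]
  have opp: "\<bar>q $ 3 + p $ 3\<bar> < R"
  proof -
    have "(q $ 3 - p $ 3) * (q $ 3 + p $ 3) =
        (p $ 1 - q $ 1) * (p $ 1 + q $ 1) + (p $ 2 - q $ 2) * (p $ 2 + q $ 2)"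
      using norm_square_3[of p] norm_square_3[of q] p q by (simp add: power2_eq_square algebra_simps)
    then have "(q $ 3 - p $ 3) * \<bar>q $ 3 + p $ 3\<bar> =
        \<bar>(p $ 1 - q $ 1) * (p $ 1 + q $ 1) + (p $ 2 - q $ 2) * (p $ 2 + q $ 2)\<bar>"
      using up m abs_mult[of "q $ 3 - p $ 3" "q $ 3 + p $ 3"] by simp
    also have "\<dots> \<le> \<bar>p $ 1 - q $ 1\<bar> * \<bar>p $ 1 + q $ 1\<bar> + \<bar>p $ 2 - q $ 2\<bar> * \<bar>p $ 2 + q $ 2\<bar>"
      unfolding abs_mult[symmetric] by (rule abs_triangle_ineq)
    also have "\<dots> \<le> (c * m) * (2 * a) + (c * m) * (2 * a)"
      using pq pa qa by (intro add_mono mult_mono) auto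
    also have "\<dots> = (m / 2) * (8 * a * c)" by simp
    finally have "(m / 2) * \<bar>q $ 3 + p $ 3\<bar> \<le> (m / 2) * (8 * a * c)"
      using mult_right_mono[OF up, of "\<bar>q $ 3 + p $ 3\<bar>"] by linarith
    then have "\<bar>q $ 3 + p $ 3\<bar> \<le> 8 * a * c" using m by simp
    then show ?thesis using small(2) by simp
  qed
  then have "q $ 3 > 0" "p $ 3 < 0" using pp qq up m R by (auto simp: abs_if split: if_splits)
  then show "R - q $ 3 \<le> 2 * a\<^sup>2 / R" "R + p $ 3 \<le> 2 * a\<^sup>2 / R" using pp qq by auto
qed

section \<open>Nearly optimal curves\<close>

text \<open>A free positive \<delta> stands in place of the exact deficit, so that deficit zero, and
  with it uniqueness, is reached by letting \<delta> tend to 0.\<close>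

lemma curve_near_optimal_estimate:
  assumes R: "R > 0"
  obtains \<delta>0 C where "\<delta>0 > 0" "C > 0"
    "\<And>T \<delta> B. T \<in> curves_X R \<Longrightarrow> mass T > 0 \<Longrightarrow> 0 < \<delta> \<Longrightarrow> \<delta> \<le> \<delta>0 \<Longrightarrow>
      (max_ratio R - \<delta>\<^sup>2) * mass T \<le> T (B0 R) \<Longrightarrow>
      (\<And>x. x \<in> cball 0 R \<Longrightarrow> norm (B x) \<le> 1) \<Longrightarrow> 1-lipschitz_on (cball 0 R) B \<Longrightarrow>
      T B - Gamma0 R B \<le> C * \<delta>"
proof -
  define l where "l = max_ratio R"
  have l0: "l > 0" unfolding l_def by (rule max_ratio_pos[OF R])
  obtain N where N: "N > 0" and near:
    "\<And>T V K \<delta>. T \<in> normal_currents R \<Longrightarrow> K > 0 \<Longrightarrow> \<delta> > 0 \<Longrightarrow> continuous_on (cball 0 R) V \<Longrightarrow>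
      (\<And>x. x \<in> cball 0 R \<Longrightarrow> norm (V x) \<le> K) \<Longrightarrow>
      (\<And>x. x \<in> cball 0 R \<Longrightarrow> V x $ 3 \<le> K * axis_dist x) \<Longrightarrow>
      (l - \<delta>\<^sup>2) * mass T \<le> T (B0 R) \<Longrightarrow> T V \<le> K * N * mass T * \<delta>"
    using near_optimal_current_small[OF R] unfolding l_def by metis
  define K1 where "K1 = l + l / R"
  define K2 where "K2 = 3 * R + 1"
  have K1: "K1 > 0" unfolding K1_def using l0 R by (simp add: add_pos_pos)
  have K2: "K2 > 0" unfolding K2_def using R by simp
  have K2_ge: "K2 \<ge> 1" unfolding K2_def using R by simp
  \<comment> \<open>\<open>d1\<close> makes the vertical displacement at least half the mass;
    \<open>d2\<close> and \<open>d3\<close> yield the two smallness conditions of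
    \<open>near_poles\<close> for \<open>a = 2 * K2 * N * \<delta>\<close>.\<close>
  define d1 where "d1 = (l / 2) / (1 + K1 * N)"
  define d2 where "d2 = 3 * R\<^sup>2 / (4 * (8 * K2\<^sup>2 * N\<^sup>2))"
  define d3 where "d3 = R / (32 * K2 * N\<^sup>2)"
  define \<delta>0 where "\<delta>0 = min (min 1 d1) (min d2 d3)"
  define C where "C = 8 * R * N + 16 * K2\<^sup>2 * N\<^sup>2 / R"
  have "d1 > 0" unfolding d1_def using l0 K1 N by (simp add: add_pos_pos)
  moreover have "d2 > 0" "d3 > 0" unfolding d2_def d3_def using R K2 N by auto
  ultimately have \<delta>0: "\<delta>0 > 0" unfolding \<delta>0_def by simp
  have C: "C > 0" unfolding C_def using R N K2 by (simp add: add_pos_pos)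
  have "T B - Gamma0 R B \<le> C * \<delta>"
    if T: "T \<in> curves_X R" and m: "mass T > 0" and \<delta>: "0 < \<delta>" "\<delta> \<le> \<delta>0"
      and opt: "(l - \<delta>\<^sup>2) * mass T \<le> T (B0 R)"
      and B1: "\<And>x. x \<in> cball 0 R \<Longrightarrow> norm (B x) \<le> 1" and BL: "1-lipschitz_on (cball 0 R) B" for T \<delta> B
  proof -
    define m where "m = mass T"
    have m0: "m > 0" using m by (simp add: m_def)
    have TN: "T \<in> normal_currents R" using T by (simp add: curves_X_def)
    have fin: "finite_mass_current R T" using TN by (simp add: normal_currents_def)
    obtain \<gamma> where \<gamma>: "simple_lip_curve R \<gamma>"
      and T\<gamma>: "\<And>B. continuous_on (cball 0 R) B \<Longrightarrow> T B = curve_current \<gamma> B"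
      using T by (auto simp: curves_X_def)
    obtain L where L: "L-lipschitz_on {0..1} \<gamma>" using \<gamma> by (auto simp: simple_lip_curve_def)
    have \<gamma>R: "\<gamma> ` {0..1} \<subseteq> cball 0 R" using \<gamma> by (simp add: simple_lip_curve_def)
    define p where "p = \<gamma> 0"
    define q where "q = \<gamma> 1"
    have pR: "p \<in> cball 0 R" and qR: "q \<in> cball 0 R" using \<gamma>R unfolding p_def q_def image_subset_iff by (meson atLeastAtMost_iff order_refl zero_le_one)+
    have ftc: "T U = u q - u p"
      if "continuous_on (cball 0 R) U"
        "\<And>x. x \<in> cball 0 R \<Longrightarrow> (u has_derivative (\<lambda>h. U x \<bullet> h)) (at x within cball 0 R)" for u U
      unfolding T\<gamma>[OF that(1)] p_def q_def
      by (rule curve_current_gradient[OF L compact_cball convex_cball \<gamma>R that(2,1)])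
    have small: "T V \<le> K * N * m * \<delta>"
      if "K > 0" "continuous_on (cball 0 R) V" "\<And>x. x \<in> cball 0 R \<Longrightarrow> norm (V x) \<le> K"
        "\<And>x. x \<in> cball 0 R \<Longrightarrow> V x $ 3 \<le> K * axis_dist x" for V K
      unfolding m_def by (rule near[OF TN that(1) \<delta>(1) that(2-4) opt])
    have \<delta>1: "\<delta> \<le> 1" and \<delta>d: "\<delta> \<le> d1" "\<delta> \<le> d2" "\<delta> \<le> d3" using \<delta>(2) by (auto simp: \<delta>0_def)
    have \<delta>sq: "\<delta>\<^sup>2 \<le> \<delta>" using \<delta>1 \<delta>(1) by (simp add: power2_eq_square mult_left_le)
    have coord: "\<bar>x $ i\<bar> \<le> R" if "x \<in> cball 0 R" for x :: "real^3" and i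
      using component_le_norm_cart[of x i] that by simp
    have horiz: "\<bar>x $ i\<bar> \<le> axis_dist x" if "i = 1 \<or> i = 2" for x :: "real^3" and i :: 3
    proof (rule power2_le_imp_le)
      show "\<bar>x $ i\<bar>\<^sup>2 \<le> (axis_dist x)\<^sup>2" using that by (auto simp: axis_dist_square)
    qed (rule axis_dist_nonneg)
    have dcoord: "((\<lambda>x::real^3. x $ i) has_derivative (\<lambda>h. h $ i)) (at x within S)" for i x S
      by (rule bounded_linear.has_derivative[OF bounded_linear_vec_nth has_derivative_ident])

    \<comment> \<open>\<open>cal_field R\<close> minus its axis value is O(\<rho>), so its action,
      at least \<open>(l - \<delta>\<^sup>2) * m\<close>, exceeds \<open>l\<close> times the
      vertical displacement by only O(\<delta> m).\<close>
    have up: "q $ 3 - p $ 3 \<ge> m / 2"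
    proof -
      have cz: "continuous_on (cball 0 R) (\<lambda>x. l *\<^sub>R zhat)" by (rule continuous_on_const)
      have Tz: "T (\<lambda>x. l *\<^sub>R zhat) = l * (q $ 3 - p $ 3)"
      proof -
        have "T (\<lambda>x. zhat) = q $ 3 - p $ 3"
          by (rule ftc[OF continuous_on_const])
            (rule has_derivative_eq_rhs[OF dcoord], simp add: inner_commute[of zhat] inner_zhat)
        then show ?thesis using current_scale[OF fin continuous_on_const, of l zhat] by simp
      qed
      have "T (\<lambda>x. cal_field R x - l *\<^sub>R zhat) \<le> K1 * N * m * \<delta>"
      proof (rule small[OF K1])
        show "continuous_on (cball 0 R) (\<lambda>x. cal_field R x - l *\<^sub>R zhat)"
          by (intro continuous_intros continuous_on_cal_field)
        fix x :: "real^3" assume x: "x \<in> cball 0 R"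
        have le: "norm (cal_field R x - l *\<^sub>R zhat) \<le> l / R * axis_dist x"
          using norm_cal_field_minus_le[OF R x] by (simp add: l_def)
        also have "\<dots> \<le> l / R * R"
          using axis_dist_le_norm[of x] x l0 R by (intro mult_left_mono) auto
        also have "\<dots> \<le> K1" using R l0 by (simp add: K1_def)
        finally show "norm (cal_field R x - l *\<^sub>R zhat) \<le> K1" .
        have "(cal_field R x - l *\<^sub>R zhat) $ 3 \<le> norm (cal_field R x - l *\<^sub>R zhat)"
          using component_le_norm_cart[of "cal_field R x - l *\<^sub>R zhat" 3] by linarith
        also note le
        also have "l / R * axis_dist x \<le> K1 * axis_dist x"
          using l0 axis_dist_nonneg by (intro mult_right_mono) (auto simp: K1_def)
        finally show "(cal_field R x - l *\<^sub>R zhat) $ 3 \<le> K1 * axis_dist x" .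
      qed
      then have "T (cal_field R) - l * (q $ 3 - p $ 3) \<le> K1 * N * m * \<delta>"
        by (simp add: current_diff[OF fin continuous_on_cal_field cz] Tz)
      moreover have "(l - \<delta>\<^sup>2) * m \<le> T (cal_field R)"
        using opt normal_current_B0[OF R TN] by (simp add: m_def)
      ultimately have "m * (l - (\<delta>\<^sup>2 + K1 * N * \<delta>)) \<le> l * (q $ 3 - p $ 3)"
        by (simp add: algebra_simps)
      moreover have "\<delta>\<^sup>2 + K1 * N * \<delta> \<le> l / 2"
      proof -
        have "\<delta>\<^sup>2 + K1 * N * \<delta> \<le> \<delta> * (1 + K1 * N)" using \<delta>sq by (simp add: algebra_simps)
        also have "\<dots> \<le> d1 * (1 + K1 * N)" using \<delta>d(1) K1 N by (intro mult_right_mono) auto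
        also have "\<dots> = l / 2"
        proof -
          have "1 + K1 * N > 0" using K1 N by (simp add: add_pos_pos)
          then show ?thesis using d1_def by (metis less_irrefl nonzero_eq_divide_eq)
        qed
        finally show ?thesis .
      qed
      then have "m * (l / 2) \<le> m * (l - (\<delta>\<^sup>2 + K1 * N * \<delta>))"
        using m0 by (intro mult_left_mono) auto
      ultimately have "l * (m / 2) \<le> l * (q $ 3 - p $ 3)" by (simp add: mult.commute[of l m])
      then show ?thesis using l0 by simp
    qed
    \<comment> \<open>Loops drop out here; the remaining alternative puts both end points on the
      sphere.\<close>
    have "q \<noteq> p" using up m0 by auto
    then have p_sphere: "norm p = R" and q_sphere: "norm q = R"
      using \<gamma> by (auto simp: simple_lip_curve_def p_def q_def)
    have m_le: "m \<le> 4 * R" using up coord[OF pR, of 3] coord[OF qR, of 3] by linarith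

    \<comment> \<open>A horizontal unit vector and its negative have no vertical component. The
      factor \<open>m\<close> is kept, since \<open>near_poles\<close> cancels it.\<close>
    have shift: "\<bar>q $ i - p $ i\<bar> \<le> N * \<delta> * m" if i: "i = 1 \<or> i = 2" for i :: 3
    proof -
      have T1: "T (\<lambda>x. axis i 1) = q $ i - p $ i"
        by (rule ftc[OF continuous_on_const])
          (rule has_derivative_eq_rhs[OF dcoord], simp add: inner_axis inner_commute[of "axis i 1"])
      have a3: "axis i (1::real) $ 3 = 0" using i by (auto simp: axis_def)
      have "T (\<lambda>x. axis i 1) \<le> 1 * N * m * \<delta>"
        by (rule small) (auto simp: a3 axis_dist_nonneg)
      moreover have "T (\<lambda>x. - axis i 1) \<le> 1 * N * m * \<delta>"
        by (rule small) (auto simp: a3 axis_dist_nonneg)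
      ultimately show ?thesis
        using T1 current_minus[OF fin continuous_on_const, of "axis i 1"] by (simp add: mult_ac abs_le_iff)
    qed

    \<comment> \<open>The gradient of \<open>x $ i * (x $ 3 - c)\<close> has vertical component
      \<open>x $ i\<close>, dominated by the distance to the axis, and norm at most 3R. The extra 1
      in \<open>K2\<close> ensures \<open>K2_ge\<close>.\<close>
    have moment: "\<bar>q $ i * (q $ 3 - c) - p $ i * (p $ 3 - c)\<bar> \<le> K2 * N * m * \<delta>"
      if i: "i = 1 \<or> i = 2" and c: "\<bar>c\<bar> \<le> R" for i :: 3 and c
    proof -
      define U where "U x = (x $ 3 - c) *\<^sub>R axis i 1 + x $ i *\<^sub>R zhat" for x :: "real^3"
      have Uc: "continuous_on (cball 0 R) U" unfolding U_def by (intro continuous_intros)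
      have TU: "T U = q $ i * (q $ 3 - c) - p $ i * (p $ 3 - c)"
      proof (rule ftc[OF Uc])
        fix x :: "real^3"
        have "((\<lambda>x. x $ i * (x $ 3 - c)) has_derivative (\<lambda>h. x $ i * (h $ 3 - 0) + h $ i * (x $ 3 - c))) (at x within cball 0 R)"
          by (intro has_derivative_mult has_derivative_diff has_derivative_const dcoord)
        then show "((\<lambda>x. x $ i * (x $ 3 - c)) has_derivative (\<lambda>h. U x \<bullet> h)) (at x within cball 0 R)"
          by (rule has_derivative_eq_rhs)
            (simp add: fun_eq_iff U_def inner_add_left inner_commute[of zhat] inner_zhat
              inner_commute[of "axis i 1"] inner_axis mult.commute)
      qed
      have U3: "U x $ 3 = x $ i" for x using i by (auto simp: U_def axis_def)
      have Un: "norm (U x) \<le> K2" if "x \<in> cball 0 R" for x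
      proof -
        have "norm (U x) \<le> \<bar>x $ 3 - c\<bar> + \<bar>x $ i\<bar>"
          unfolding U_def using norm_triangle_ineq[of "(x $ 3 - c) *\<^sub>R axis i 1" "x $ i *\<^sub>R zhat"] by simp
        then show ?thesis using coord[OF that, of 3] coord[OF that, of i] c by (simp add: K2_def)
      qed
      have U\<rho>: "\<bar>U x $ 3\<bar> \<le> K2 * axis_dist x" for x
      proof -
        have "1 * axis_dist x \<le> K2 * axis_dist x"
          using K2_ge axis_dist_nonneg by (intro mult_right_mono) auto
        then show ?thesis using horiz[OF i, of x] by (simp add: U3)
      qed
      have "T U \<le> K2 * N * m * \<delta>"
        using U\<rho> by (intro small[OF K2 Uc Un]) (auto simp: abs_le_iff)
      moreover have "T (\<lambda>x. - U x) \<le> K2 * N * m * \<delta>"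
        using U\<rho> Un by (intro small[OF K2 continuous_on_minus[OF Uc]]) (auto simp: abs_le_iff)
      ultimately show ?thesis
        unfolding TU[symmetric] using current_minus[OF fin Uc] by (simp add: abs_le_iff)
    qed
    \<comment> \<open>Taking for \<open>c\<close> the height of one end point removes that point
      from \<open>moment\<close>; dividing by the displacement, at least \<open>m / 2\<close>, gives
      the factor 2 and cancels \<open>m\<close>.\<close>
    define a where "a = 2 * K2 * N * \<delta>"
    have end_bound: "\<bar>t\<bar> \<le> a" if "\<bar>t * (q $ 3 - p $ 3)\<bar> \<le> K2 * N * m * \<delta>" for t
    proof -
      have "\<bar>t\<bar> * (m / 2) \<le> \<bar>t\<bar> * (q $ 3 - p $ 3)" using up by (intro mult_left_mono) auto
      also have "\<dots> = \<bar>t * (q $ 3 - p $ 3)\<bar>" using up m0 by (simp add: abs_mult)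
      also have "\<dots> \<le> a * (m / 2)" using that by (simp add: a_def mult_ac)
      finally show ?thesis using m0 by simp
    qed
    have qa: "\<bar>q $ i\<bar> \<le> a" if "i = 1 \<or> i = 2" for i :: 3
      using end_bound[of "q $ i"] moment[OF that coord[OF pR, of 3]] by simp
    have pa: "\<bar>p $ i\<bar> \<le> a" if "i = 1 \<or> i = 2" for i :: 3
    proof (rule end_bound)
      have "q $ i * (q $ 3 - q $ 3) - p $ i * (p $ 3 - q $ 3) = p $ i * (q $ 3 - p $ 3)"
        by (simp add: algebra_simps)
      then show "\<bar>p $ i * (q $ 3 - p $ 3)\<bar> \<le> K2 * N * m * \<delta>"
        using moment[OF that coord[OF qR, of 3]] by simp
    qed
    have a_small: "2 * a\<^sup>2 \<le> 3 * R\<^sup>2 / 4"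
    proof -
      have "2 * a\<^sup>2 = 8 * K2\<^sup>2 * N\<^sup>2 * \<delta>\<^sup>2" by (simp add: a_def power_mult_distrib)
      also have "\<dots> \<le> 8 * K2\<^sup>2 * N\<^sup>2 * d2" using \<delta>sq \<delta>d(2) by (intro mult_left_mono) auto
      also have "\<dots> = 3 * R\<^sup>2 / 4" using K2 N by (simp add: d2_def)
      finally show ?thesis .
    qed
    have a_small': "8 * a * (N * \<delta>) < R"
    proof -
      have "8 * a * (N * \<delta>) = 16 * K2 * N\<^sup>2 * \<delta>\<^sup>2" by (simp add: a_def power2_eq_square)
      also have "\<dots> \<le> 16 * K2 * N\<^sup>2 * d3" using \<delta>sq \<delta>d(3) K2 by (intro mult_left_mono) auto
      also have "\<dots> = R / 2" using K2 N by (simp add: d3_def)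
      finally show ?thesis using R by simp
    qed
    have poles: "R - q $ 3 \<le> 2 * a\<^sup>2 / R" "R + p $ 3 \<le> 2 * a\<^sup>2 / R"
      using near_poles[OF R p_sphere q_sphere pa pa qa qa shift shift m0 up a_small a_small'] by simp_all

    have Bc: "continuous_on (cball 0 R) B" by (rule lipschitz_on_continuous_on[OF BL])
    define b where "b z = B (vector [0, 0, z]) $ 3" for z
    have vR: "vector [0, 0, z] \<in> cball (0::real^3) R" if "z \<in> {-R..R}" for z
    proof -
      have "norm (z *\<^sub>R zhat) \<le> R" using that by (simp add: abs_le_iff)
      then show ?thesis by (simp add: scaleR_zhat)
    qed
    have bc: "continuous_on {-R..R} b" unfolding b_def
      by (intro continuous_on_component continuous_on_compose2[OF Bc continuous_on_vertical]) (use vR in auto)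
    have b1: "\<bar>b z\<bar> \<le> 1" if "z \<in> {-R..R}" for z
      using component_le_norm_cart[of "B (vector [0, 0, z])" 3] B1[OF vR[OF that]] by (simp add: b_def)
    define \<beta> where "\<beta> z = integral {-R..z} b" for z
    define U where "U x = b (x $ 3) *\<^sub>R zhat" for x :: "real^3"
    have x3: "x $ 3 \<in> {-R..R}" if "x \<in> cball 0 R" for x :: "real^3"
      using coord[OF that, of 3] by (auto simp: abs_le_iff)
    have Uc: "continuous_on (cball 0 R) U" unfolding U_def
      by (intro continuous_on_scaleR continuous_on_const continuous_on_compose2[OF bc] continuous_on_component continuous_on_id)
        (use x3 in auto)
    have TU: "T U = \<beta> (q $ 3) - \<beta> (p $ 3)"
    proof (rule ftc[OF Uc])
      fix x :: "real^3" assume x: "x \<in> cball 0 R"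
      have "(\<beta> has_derivative (\<lambda>h. h * b (x $ 3))) (at (x $ 3) within {-R..R})"
        using integral_has_vector_derivative[OF bc x3[OF x]] by (simp add: \<beta>_def[abs_def] has_vector_derivative_def)
      then have "(\<beta> has_derivative (\<lambda>h. h * b (x $ 3))) (at (x $ 3) within (\<lambda>x::real^3. x $ 3) ` cball 0 R)"
        by (rule has_derivative_subset) (use x3 in auto)
      from has_derivative_in_compose[OF dcoord this]
      show "((\<lambda>x. \<beta> (x $ 3)) has_derivative (\<lambda>h. U x \<bullet> h)) (at x within cball 0 R)"
        by (rule has_derivative_eq_rhs) (simp add: fun_eq_iff U_def inner_commute[of zhat] inner_zhat)
    qed
    have G0: "Gamma0 R B = \<beta> R"
      unfolding Gamma0_def \<beta>_def b_def[symmetric]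
      by (rule set_borel_integral_eq_integral(2)[OF borel_integrable_atLeastAtMost'[OF bc]])
    have bint: "b integrable_on {s..t}" if "-R \<le> s" "t \<le> R" for s t
      by (rule integrable_continuous_real[OF continuous_on_subset[OF bc]]) (use that in auto)
    have b_le: "\<bar>integral {s..t} b\<bar> \<le> t - s" if "-R \<le> s" "s \<le> t" "t \<le> R" for s t
    proof -
      have "norm (integral {s..t} b) \<le> 1 * (t - s)"
        by (rule integral_bound[OF that(2)]) (use that b1 continuous_on_subset[OF bc] in auto)
      then show ?thesis by simp
    qed
    \<comment> \<open>The two values differ by the integrals of \<open>b\<close> over the gaps
      between the end heights and the poles; each gap is already quadratic in \<delta>.\<close>
    have "\<beta> (q $ 3) + integral {q $ 3..R} b = \<beta> R"
      unfolding \<beta>_def using x3[OF qR] by (intro Henstock_Kurzweil_Integration.integral_combine bint) auto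
    then have vert: "T U - Gamma0 R B \<le> 4 * a\<^sup>2 / R"
      using b_le[of "q $ 3" R] b_le[of "-R" "p $ 3"] poles x3[OF pR] x3[OF qR]
      by (simp add: TU G0 \<beta>_def abs_le_iff)

    have "T (\<lambda>x. B x - U x) \<le> 2 * N * m * \<delta>"
    proof (rule small)
      show "continuous_on (cball 0 R) (\<lambda>x. B x - U x)" by (intro continuous_intros Bc Uc)
      fix x :: "real^3" assume x: "x \<in> cball 0 R"
      have "norm (B x - U x) \<le> norm (B x) + norm (U x)" by (rule norm_triangle_ineq4)
      also have "\<dots> \<le> 1 + 1" using B1[OF x] b1[OF x3[OF x]] by (intro add_mono) (auto simp: U_def)
      finally show "norm (B x - U x) \<le> 2" by simp
      have "(B x - U x) $ 3 = (B x - B (vector [0, 0, x $ 3])) $ 3" by (simp add: U_def b_def)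
      also have "\<dots> \<le> norm (B x - B (vector [0, 0, x $ 3]))"
        using component_le_norm_cart[of "B x - B (vector [0, 0, x $ 3])" 3] by linarith
      also have "\<dots> \<le> norm (x - vector [0, 0, x $ 3])"
        using lipschitz_onD[OF BL x vR[OF x3[OF x]]] by (simp add: dist_norm)
      also have "\<dots> = axis_dist x"
      proof (rule power2_eq_imp_eq)
        show "(norm (x - vector [0, 0, x $ 3]))\<^sup>2 = (axis_dist x)\<^sup>2"
          unfolding norm_square_3 axis_dist_square by simp
      qed (auto simp: axis_dist_nonneg)
      finally show "(B x - U x) $ 3 \<le> 2 * axis_dist x" using axis_dist_nonneg[of x] by linarith
    qed simp
    also have "\<dots> \<le> 2 * N * (4 * R) * \<delta>"
      using m_le N \<delta>(1) by (intro mult_right_mono mult_left_mono) auto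
    finally have "T B - T U \<le> 8 * R * N * \<delta>" by (simp add: current_diff[OF fin Bc Uc] mult_ac)
    moreover have "4 * a\<^sup>2 / R \<le> (16 * K2\<^sup>2 * N\<^sup>2 / R) * \<delta>"
    proof -
      have "4 * a\<^sup>2 / R = (16 * K2\<^sup>2 * N\<^sup>2 / R) * \<delta>\<^sup>2" by (simp add: a_def power_mult_distrib)
      also have "\<dots> \<le> (16 * K2\<^sup>2 * N\<^sup>2 / R) * \<delta>" using \<delta>sq R by (intro mult_left_mono) auto
      finally show ?thesis .
    qed
    ultimately show ?thesis using vert by (simp add: C_def distrib_right)
  qed
  then show thesis using that[OF \<delta>0 C] unfolding l_def by blast
qed

text \<open>Both suprema are nonnegative, so each is at most 1. Boundedness is checked first because
  a real \<open>SUP\<close> over an unbounded set carries no information.\<close>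

lemma C01_norm_le_1D:
  assumes R: "R > 0" and B: "lipT R B" and le: "C01_norm R B \<le> 1"
  shows "\<And>x. x \<in> cball 0 R \<Longrightarrow> norm (B x) \<le> 1" "1-lipschitz_on (cball 0 R) B"
proof -
  obtain L where L: "L-lipschitz_on (cball 0 R) B" using B by (auto simp: lipT_def)
  define P where "P = {(x::real^3, y). x \<in> cball 0 R \<and> y \<in> cball 0 R \<and> x \<noteq> y}"
  define Q where "Q p = norm (B (fst p) - B (snd p)) / dist (fst p) (snd p)" for p
  have bdd1: "bdd_above ((\<lambda>x. norm (B x)) ` cball 0 R)"
    by (intro bounded_imp_bdd_above compact_imp_bounded compact_continuous_image
        continuous_on_norm lipschitz_on_continuous_on[OF L] compact_cball)
  have bdd2: "bdd_above (Q ` P)"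
    by (rule bdd_aboveI2[where M = L])
      (use lipschitz_onD[OF L] in \<open>auto simp: P_def Q_def dist_norm pos_divide_le_eq\<close>)
  have C: "C01_norm R B = (SUP x\<in>cball 0 R. norm (B x)) + (SUP p\<in>P. Q p)"
    by (simp add: C01_norm_def P_def Q_def)
  have zR: "R *\<^sub>R zhat \<in> cball 0 R" "R *\<^sub>R zhat \<noteq> 0" using R by auto
  have "0 \<le> Q (0, R *\<^sub>R zhat)" by (simp add: Q_def)
  also have "\<dots> \<le> (SUP p\<in>P. Q p)"
    by (rule cSUP_upper[OF _ bdd2]) (use zR R in \<open>auto simp: P_def\<close>)
  finally have S2: "0 \<le> (SUP p\<in>P. Q p)" .
  have "0 \<le> norm (B 0)" by simp
  also have "\<dots> \<le> (SUP x\<in>cball 0 R. norm (B x))"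
    by (rule cSUP_upper[OF _ bdd1]) (use R in simp)
  finally have S1: "0 \<le> (SUP x\<in>cball 0 R. norm (B x))" .
  show "norm (B x) \<le> 1" if "x \<in> cball 0 R" for x
    using cSUP_upper[OF that bdd1] S2 le C by linarith
  show "1-lipschitz_on (cball 0 R) B"
  proof (rule lipschitz_onI)
    fix x y :: "real^3" assume xy: "x \<in> cball 0 R" "y \<in> cball 0 R"
    show "dist (B x) (B y) \<le> 1 * dist x y"
    proof (cases "x = y")
      case False
      then have "(x, y) \<in> P" using xy by (simp add: P_def)
      from cSUP_upper[OF this bdd2] have "Q (x, y) \<le> 1" using S1 le C by linarith
      then show ?thesis using False by (simp add: Q_def dist_norm pos_divide_le_eq)
    qed simp
  qed simp
qed

lemma smooth3_lipschitz:
  assumes "smooth3 f" "compact S" "convex S"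
  shows "\<exists>L. L-lipschitz_on S f"
proof -
  obtain K where K: "\<And>x. x \<in> S \<Longrightarrow> norm (grad3 f x) \<le> K" and K0: "K \<ge> 0"
    using compact_imp_bounded[OF compact_continuous_image[OF smooth3_D(2)[OF assms(1)] assms(2)]]
    unfolding bounded_pos by (auto intro: less_imp_le)
  have "K-lipschitz_on S f"
  proof (rule lipschitz_onI)
    fix x y assume xy: "x \<in> S" "y \<in> S"
    have "norm (f x - f y) \<le> K * norm (x - y)"
    proof (rule differentiable_bound[OF assms(3) _ _ xy])
      show "(f has_derivative (\<lambda>h. grad3 f z \<bullet> h)) (at z within S)" for z
        using has_derivative_grad3[OF smooth3_D(1)[OF assms(1)]] by (rule has_derivative_at_withinI)
      show "onorm (\<lambda>h. grad3 f z \<bullet> h) \<le> K" if "z \<in> S" for z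
      proof (rule onorm_bound[OF K0])
        show "norm (grad3 f z \<bullet> h) \<le> K * norm h" for h
          using Cauchy_Schwarz_ineq2[of "grad3 f z" h] K[OF that]
          by (smt (verit) mult_right_mono norm_ge_zero real_norm_def)
      qed
    qed
    then show "dist (f x) (f y) \<le> K * dist x y" by (simp add: dist_norm)
  qed (rule K0)
  then show ?thesis ..
qed

text \<open>Brings test forms, after rescaling, under the estimate for Lipschitz fields, as
  uniqueness of the current requires.\<close>

lemma test_form_lipschitz:
  assumes w: "test_form w"
  shows "\<exists>L. L-lipschitz_on (cball 0 R) w"
proof -
  have "\<forall>i. \<exists>L. L-lipschitz_on (cball 0 R) (\<lambda>x. w x $ i)"
    using w smooth3_lipschitz[OF _ compact_cball convex_cball] by (auto simp: test_form_def)
  then obtain L where L: "\<And>i. (L i)-lipschitz_on (cball 0 R) (\<lambda>x. w x $ i)" by metis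
  have "(\<Sum>i\<in>UNIV. L i)-lipschitz_on (cball 0 R) w"
  proof (rule lipschitz_onI)
    fix x y :: "real^3" assume xy: "x \<in> cball 0 R" "y \<in> cball 0 R"
    have "dist (w x) (w y) \<le> (\<Sum>i\<in>UNIV. \<bar>(w x - w y) $ i\<bar>)"
      unfolding dist_norm by (rule norm_le_l1_cart)
    also have "\<dots> \<le> (\<Sum>i\<in>UNIV. L i * dist x y)"
      using lipschitz_onD[OF L xy] by (intro sum_mono) (simp add: dist_real_def)
    finally show "dist (w x) (w y) \<le> (\<Sum>i\<in>UNIV. L i) * dist x y" by (simp add: sum_distrib_right)
  qed (intro sum_nonneg lipschitz_on_nonneg[OF L])
  then show ?thesis ..
qed

lemma le_0_if_le_small_multiples:
  fixes t C d :: real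
  assumes "d > 0" and le: "\<And>e. 0 < e \<Longrightarrow> e \<le> d \<Longrightarrow> t \<le> C * e"
  shows "t \<le> 0"
proof -
  have "((\<lambda>e. C * e) \<longlongrightarrow> C * 0) (at_right 0)" by (intro tendsto_intros)
  moreover have "\<forall>\<^sub>F e in at_right 0. t \<le> C * e"
    by (rule eventually_at_rightI[OF _ assms(1)]) (simp add: le)
  ultimately have "t \<le> C * 0" by (rule tendsto_lowerbound) simp
  then show ?thesis by simp
qed

theorem mainTheorem5:
  fixes R :: real
  assumes "R > 0"
  shows "Gamma0 R \<in> curves_X R
    \<and> (\<forall>\<Gamma>\<in>normal_currents R. ratio R \<Gamma> \<le> ratio R (Gamma0 R))
    \<and> (\<forall>\<Gamma>\<in>curves_X R. ratio R \<Gamma> = ratio R (Gamma0 R) \<longrightarrow> same_current \<Gamma> (Gamma0 R))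
    \<and> (\<exists>C0>0. \<forall>\<Gamma>\<in>curves_X R.
          ratio R (Gamma0 R) - ratio R \<Gamma> \<ge> C0 * min ((dual_norm_diff R \<Gamma> (Gamma0 R))\<^sup>2) 1)"
proof (intro conjI ballI impI)
  note R = assms
  note fin0 = finite_mass_current_Gamma0[OF R]
  show "Gamma0 R \<in> curves_X R" by (rule Gamma0_in_curves_X[OF R])
  show "ratio R \<Gamma> \<le> ratio R (Gamma0 R)" if "\<Gamma> \<in> normal_currents R" for \<Gamma>
    unfolding ratio_Gamma0[OF R] by (rule ratio_le_max_ratio[OF R that])
  define l where "l = max_ratio R"
  have l0: "l > 0" unfolding l_def by (rule max_ratio_pos[OF R])
  obtain \<delta>0 C where \<delta>0: "\<delta>0 > 0" and C: "C > 0" and est: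
    "\<And>T \<delta> B. T \<in> curves_X R \<Longrightarrow> mass T > 0 \<Longrightarrow> 0 < \<delta> \<Longrightarrow> \<delta> \<le> \<delta>0 \<Longrightarrow>
      (l - \<delta>\<^sup>2) * mass T \<le> T (B0 R) \<Longrightarrow>
      (\<And>x. x \<in> cball 0 R \<Longrightarrow> norm (B x) \<le> 1) \<Longrightarrow> 1-lipschitz_on (cball 0 R) B \<Longrightarrow>
      T B - Gamma0 R B \<le> C * \<delta>"
    using curve_near_optimal_estimate[OF R] unfolding l_def by metis
  have finX: "finite_mass_current R T" "T \<in> normal_currents R" if "T \<in> curves_X R" for T
    using that by (auto simp: curves_X_def normal_currents_def)
  have opt: "(l - \<delta>\<^sup>2) * mass T \<le> T (B0 R)"
    if "mass T > 0" "l - ratio R T \<le> \<delta>\<^sup>2" for T \<delta>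
  proof -
    have "(l - \<delta>\<^sup>2) * mass T \<le> ratio R T * mass T" using that by (intro mult_right_mono) auto
    then show ?thesis using that by (simp add: ratio_def)
  qed
  have mass_pos: "mass T > 0" if T: "T \<in> curves_X R" and "ratio R T > 0" for T
    using mass_nonneg[OF finX(1)[OF T]] that(2) by (cases "mass T = 0") (auto simp: ratio_def)

  show "same_current \<Gamma> (Gamma0 R)" if \<Gamma>: "\<Gamma> \<in> curves_X R" and eq: "ratio R \<Gamma> = ratio R (Gamma0 R)" for \<Gamma>
    unfolding same_current_def
  proof (intro allI impI)
    fix w assume w: "test_form w"
    have wc: "continuous_on (cball 0 R) w" by (rule test_form_continuous_on[OF w])
    have m: "mass \<Gamma> > 0" using mass_pos[OF \<Gamma>] eq l0 by (simp add: ratio_Gamma0[OF R] l_def)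
    obtain L where L: "L-lipschitz_on (cball 0 R) w" using test_form_lipschitz[OF w] by blast
    have L0: "L \<ge> 0" by (rule lipschitz_on_nonneg[OF L])
    obtain K where K: "\<And>x. x \<in> cball 0 R \<Longrightarrow> norm (w x) \<le> K" and K0: "K > 0"
      using compact_imp_bounded[OF compact_continuous_image[OF wc compact_cball]]
      unfolding bounded_pos by blast
    \<comment> \<open>Scaling by 1/(K+L) makes the form admissible for \<open>est\<close>; both
      signs of \<open>c\<close> together give equality.\<close>
    have le: "c * (\<Gamma> w - Gamma0 R w) \<le> 0" if c: "\<bar>c\<bar> * (K + L) \<le> 1" for c
    proof (rule le_0_if_le_small_multiples[OF \<delta>0])
      fix \<delta> :: real assume \<delta>: "0 < \<delta>" "\<delta> \<le> \<delta>0"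
      have "\<Gamma> (\<lambda>x. c *\<^sub>R w x) - Gamma0 R (\<lambda>x. c *\<^sub>R w x) \<le> C * \<delta>"
      proof (rule est[OF \<Gamma> m \<delta> opt[OF m]])
        show "l - ratio R \<Gamma> \<le> \<delta>\<^sup>2" by (simp add: eq ratio_Gamma0[OF R] l_def)
        show "norm (c *\<^sub>R w x) \<le> 1" if "x \<in> cball 0 R" for x
        proof -
          have "\<bar>c\<bar> * norm (w x) \<le> \<bar>c\<bar> * (K + L)" using K[OF that] L0 by (intro mult_left_mono) auto
          then show ?thesis using c by simp
        qed
        show "1-lipschitz_on (cball 0 R) (\<lambda>x. c *\<^sub>R w x)"
        proof (rule lipschitz_on_le)
          show "(\<bar>c\<bar> * L)-lipschitz_on (cball 0 R) (\<lambda>x. c *\<^sub>R w x)"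
            by (rule lipschitz_on_cmult[OF L])
          have "\<bar>c\<bar> * L \<le> \<bar>c\<bar> * (K + L)" using K0 by (intro mult_left_mono) auto
          then show "\<bar>c\<bar> * L \<le> 1" using c by simp
        qed
      qed
      then show "c * (\<Gamma> w - Gamma0 R w) \<le> C * \<delta>"
        by (simp add: current_scale[OF finX(1)[OF \<Gamma>] wc] current_scale[OF fin0 wc] right_diff_distrib)
    qed
    have "K + L > 0" using K0 L0 by simp
    then show "\<Gamma> w = Gamma0 R w"
      using le[of "1 / (K + L)"] le[of "- (1 / (K + L))"] by (simp add: divide_le_0_iff zero_le_divide_iff)
  qed

  \<comment> \<open>\<open>1 / C\<^sup>2\<close> comes from d \<le> C sqrt D. The other two entries
    cover what \<open>est\<close> does not reach: a deficit above \<open>\<delta>0\<^sup>2\<close>,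
    and zero mass, where the ratio is 0 and the deficit is \<open>l\<close>.\<close>
  define C0 where "C0 = min (min l (\<delta>0\<^sup>2)) (1 / C\<^sup>2)"
  have C0: "C0 > 0" using l0 \<delta>0 C by (simp add: C0_def)
  have "ratio R (Gamma0 R) - ratio R \<Gamma> \<ge> C0 * min ((dual_norm_diff R \<Gamma> (Gamma0 R))\<^sup>2) 1"
    if \<Gamma>: "\<Gamma> \<in> curves_X R" for \<Gamma>
  proof -
    define D where "D = l - ratio R \<Gamma>"
    define d where "d = dual_norm_diff R \<Gamma> (Gamma0 R)"
    have D0: "D \<ge> 0" using ratio_le_max_ratio[OF R finX(2)[OF \<Gamma>]] by (simp add: D_def l_def)
    have "C0 * min (d\<^sup>2) 1 \<le> D"
    proof (cases "mass \<Gamma> > 0 \<and> D \<le> \<delta>0\<^sup>2")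
      case False
      have "C0 \<le> D"
      proof (cases "mass \<Gamma> > 0")
        case True
        then show ?thesis using False by (auto simp: C0_def)
      next
        case m: False
        then have "ratio R \<Gamma> \<le> 0" using mass_pos[OF \<Gamma>] by force
        then show ?thesis by (auto simp: C0_def D_def)
      qed
      moreover have "C0 * min (d\<^sup>2) 1 \<le> C0 * 1" using C0 by (intro mult_left_mono) auto
      ultimately show ?thesis by simp
    next
      case True
      then have m: "mass \<Gamma> > 0" and D\<delta>: "sqrt D \<le> \<delta>0" using \<delta>0 D0 by (auto intro: real_le_lsqrt)
      define A where "A = {B. lipT R B \<and> C01_norm R B \<le> 1}"
      have est': "\<Gamma> B - Gamma0 R B \<le> C * \<delta>" if "B \<in> A" "0 < \<delta>" "\<delta> \<le> \<delta>0" "sqrt D \<le> \<delta>" for B \<delta>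
      proof (rule est[OF \<Gamma> m that(2,3) opt[OF m]])
        have "(sqrt D)\<^sup>2 \<le> \<delta>\<^sup>2" using that(4) D0 by (intro power_mono) auto
        then show "l - ratio R \<Gamma> \<le> \<delta>\<^sup>2" using D0 by (simp add: D_def)
      qed (use that(1) C01_norm_le_1D[OF R] in \<open>auto simp: A_def\<close>)
      \<comment> \<open>The zero field makes the index set of the supremum nonempty and gives d
        \<ge> 0, needed before squaring.\<close>
      have zero: "(\<lambda>x. 0) \<in> A"
      proof -
        have "(SUP x\<in>cball (0::real^3) R. 0::real) = 0" by (rule cSUP_const) (use R in auto)
        moreover have "{(x::real^3, y). x \<in> cball 0 R \<and> y \<in> cball 0 R \<and> x \<noteq> y} \<noteq> {}"
        proof -
          have "(0, R *\<^sub>R zhat) \<in> {(x::real^3, y). x \<in> cball 0 R \<and> y \<in> cball 0 R \<and> x \<noteq> y}"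
            using R by auto
          then show ?thesis by blast
        qed
        ultimately have "C01_norm R (\<lambda>x. 0) = 0" by (simp add: C01_norm_def)
        moreover have "lipT R (\<lambda>x. 0)"
          unfolding lipT_def by (auto intro!: exI[of _ 0] lipschitz_intros)
        ultimately show ?thesis by (simp add: A_def)
      qed
      have d_le: "d \<le> C * \<delta>" if "0 < \<delta>" "\<delta> \<le> \<delta>0" "sqrt D \<le> \<delta>" for \<delta>
        unfolding d_def dual_norm_diff_def A_def[symmetric]
        using zero est' that by (intro cSUP_least) auto
      have d0: "d \<ge> 0"
      proof -
        have "bdd_above ((\<lambda>B. \<Gamma> B - Gamma0 R B) ` A)"
          by (rule bdd_aboveI2[where M = "C * \<delta>0"]) (use est' \<delta>0 D\<delta> in auto)
        from cSUP_upper[OF zero this] have "\<Gamma> (\<lambda>x. 0) - Gamma0 R (\<lambda>x. 0) \<le> d"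
          by (simp add: d_def dual_norm_diff_def A_def)
        then show ?thesis
          using current_scale[OF finX(1)[OF \<Gamma>] continuous_on_const, where c = 0]
            current_scale[OF fin0 continuous_on_const, where c = 0] by simp
      qed
      \<comment> \<open>\<open>sqrt D\<close> is the natural \<delta>, but \<open>est\<close> needs
        it positive; for D = 0 all small \<delta> are used instead.\<close>
      have "d \<le> C * sqrt D"
      proof (cases "D = 0")
        case True
        then show ?thesis using le_0_if_le_small_multiples[OF \<delta>0 d_le] by simp
      next
        case False
        then show ?thesis using d_le[of "sqrt D"] D0 D\<delta> by simp
      qed
      then have "d\<^sup>2 \<le> (C * sqrt D)\<^sup>2" using d0 by (intro power_mono) auto
      then have "d\<^sup>2 \<le> C\<^sup>2 * D" using D0 by (simp add: power_mult_distrib)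
      then have "1 / C\<^sup>2 * d\<^sup>2 \<le> D" using C by (simp add: field_simps)
      moreover have "C0 * min (d\<^sup>2) 1 \<le> 1 / C\<^sup>2 * d\<^sup>2"
        using C0 by (intro mult_mono) (auto simp: C0_def)
      ultimately show ?thesis by linarith
    qed
    then show ?thesis by (simp add: D_def d_def ratio_Gamma0[OF R] l_def)
  qed
  then show "\<exists>C0>0. \<forall>\<Gamma>\<in>curves_X R.
      ratio R (Gamma0 R) - ratio R \<Gamma> \<ge> C0 * min ((dual_norm_diff R \<Gamma> (Gamma0 R))\<^sup>2) 1"
    using C0 by blast
qed

end
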